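(* Let $(G,V)$ be a pair with the two-eigenvalue property and suppose $G/Z(G)$ has positive dimension. Then the derived group $[G_0,G_0]$ of the identity component $G_0$ is a simple Lie group, and $G=G_0\,Z(G)$.
   Context: Let $G$ be a compact Lie group (not necessarily connected) and $V$ a faithful, irreducible, finite-dimensional unitary representation of $G$. The pair $(G,V)$ has the two-eigenvalue property if there is a conjugacy class $[g]$ of $G$ such that (i) the subgroup generated by $[g]$ is dense in $G$, and (ii) every element of $[g]$ acts on $V$ with exactly two distinct eigenvalues whose ratio is not $-1$. $Z(G)$ is the center of $G$ and $G_0$ the identity component. *)

theory Defs
  imports "HOL-Analysis.Analysis"
begin

text \<open>Complex n x n matrices acting on V = complex^'n.  A compact Lie group G with a
faithful unitary representation V is identified with its image, a closed subgroup
of the unitary group U(V).\<close>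

type_synonym 'n cmat = "complex^'n^'n"

definition adj_mat :: "'n::finite cmat \<Rightarrow> 'n cmat" where
  "adj_mat U = (\<chi> i j. cnj (U $ j $ i))"

definition unitary_mat :: "'n::finite cmat \<Rightarrow> bool" where
  "unitary_mat U \<longleftrightarrow> U ** adj_mat U = mat 1 \<and> adj_mat U ** U = mat 1"

definition is_subgroup :: "'n::finite cmat set \<Rightarrow> bool" where
  "is_subgroup H \<longleftrightarrow> mat 1 \<in> H \<and> (\<forall>a\<in>H. \<forall>b\<in>H. a ** b \<in> H)
     \<and> (\<forall>a\<in>H. invertible a \<and> matrix_inv a \<in> H)"

definition compact_unitary_group :: "'n::finite cmat set \<Rightarrow> bool" where
  "compact_unitary_group G \<longleftrightarrow> is_subgroup G \<and> closed G \<and> (\<forall>g\<in>G. unitary_mat g)"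

definition gen_subgroup :: "'n::finite cmat set \<Rightarrow> 'n cmat set" where
  "gen_subgroup S = \<Inter>{H. is_subgroup H \<and> S \<subseteq> H}"

definition complex_subspace :: "(complex^'n::finite) set \<Rightarrow> bool" where
  "complex_subspace W \<longleftrightarrow> 0 \<in> W \<and> (\<forall>x\<in>W. \<forall>y\<in>W. x + y \<in> W)
     \<and> (\<forall>c::complex. \<forall>x\<in>W. c *s x \<in> W)"

definition irreducible_rep :: "'n::finite cmat set \<Rightarrow> bool" where
  "irreducible_rep G \<longleftrightarrow> (\<forall>W. complex_subspace W \<and> (\<forall>g\<in>G. \<forall>w\<in>W. g *v w \<in> W)
      \<longrightarrow> W = {0} \<or> W = UNIV)"

definition eigenvalues_mat :: "'n::finite cmat \<Rightarrow> complex set" where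
  "eigenvalues_mat A = {c. \<exists>v. v \<noteq> 0 \<and> A *v v = c *s v}"

definition conj_class :: "'n::finite cmat set \<Rightarrow> 'n cmat \<Rightarrow> 'n cmat set" where
  "conj_class G g = {h ** g ** matrix_inv h | h. h \<in> G}"

definition two_eigenvalue_property :: "'n::finite cmat set \<Rightarrow> bool" where
  "two_eigenvalue_property G \<longleftrightarrow> (\<exists>g\<in>G.
     G \<subseteq> closure (gen_subgroup (conj_class G g)) \<and>
     (\<forall>x\<in>conj_class G g. card (eigenvalues_mat x) = 2 \<and>
        (\<forall>a\<in>eigenvalues_mat x. \<forall>b\<in>eigenvalues_mat x. a \<noteq> b \<longrightarrow> a / b \<noteq> -1)))"

definition center :: "'n::finite cmat set \<Rightarrow> 'n cmat set" where
  "center G = {z\<in>G. \<forall>g\<in>G. z ** g = g ** z}"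

definition identity_component :: "'n::finite cmat set \<Rightarrow> 'n cmat set" where
  "identity_component G = connected_component_set G (mat 1)"

definition commutator_subgroup :: "'n::finite cmat set \<Rightarrow> 'n cmat set" where
  "commutator_subgroup H =
     gen_subgroup {a ** b ** matrix_inv a ** matrix_inv b | a b. a \<in> H \<and> b \<in> H}"

fun matpow :: "'n::finite cmat \<Rightarrow> nat \<Rightarrow> 'n cmat" where
  "matpow A 0 = mat 1"
| "matpow A (Suc k) = A ** matpow A k"

definition mexp :: "'n::finite cmat \<Rightarrow> 'n cmat" where
  "mexp A = (\<Sum>k. (1 / fact k) *\<^sub>R matpow A k)"

definition lie_algebra :: "'n::finite cmat set \<Rightarrow> 'n cmat set" where
  "lie_algebra H = {X. \<forall>t::real. mexp (t *\<^sub>R X) \<in> H}"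

definition lie_ideal :: "'n::finite cmat set \<Rightarrow> 'n cmat set \<Rightarrow> bool" where
  "lie_ideal L I \<longleftrightarrow> subspace I \<and> I \<subseteq> L \<and> (\<forall>X\<in>L. \<forall>Y\<in>I. X ** Y - Y ** X \<in> I)"

definition simple_lie_algebra :: "'n::finite cmat set \<Rightarrow> bool" where
  "simple_lie_algebra L \<longleftrightarrow> (\<exists>X\<in>L. \<exists>Y\<in>L. X ** Y \<noteq> Y ** X) \<and>
     (\<forall>I. lie_ideal L I \<longrightarrow> I = {0} \<or> I = L)"

definition simple_lie_group :: "'n::finite cmat set \<Rightarrow> bool" where
  "simple_lie_group H \<longleftrightarrow> is_subgroup H \<and> connected H \<and> simple_lie_algebra (lie_algebra H)"

definition quotient_by_center_dim :: "'n::finite cmat set \<Rightarrow> nat" where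
  "quotient_by_center_dim G = dim (lie_algebra G) - dim (lie_algebra (center G))"

end

theory Submission
  imports Defs
begin

text \<open>Let \<open>g = l P + m (1 - P)\<close> generate \<open>G\<close> up to conjugation and closure, and let \<open>L\<close> be the Lie
algebra of \<open>G\<close>. With \<open>w = l / m\<close> one has \<open>Ad(g) X - Ad(g\<inverse>) X = 2 Im w [\<i> P, X]\<close>; as \<open>w\<close> is not real,
\<open>[\<i> P, L] \<subseteq> L\<close>. For the invariant inner product \<open>Re tr (A B*)\<close>, the component \<open>Z\<close> of \<open>\<i> P\<close>
orthogonal to \<open>L\<close> therefore commutes with \<open>L\<close>. If a matrix with two eigenvalues is a sum of two
commuting parts that act on different tensor factors of an irreducible representation, one of the parts
is scalar. Hence \<open>\<i> P = Y + c\<close> with \<open>Y \<in> L\<close> and \<open>c\<close> scalar, the alternative being that \<open>L\<close> is central.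
So \<open>g\<close> is a scalar times an exponential of \<open>L\<close>, which gives \<open>G = G\<^sub>0 Z(G)\<close>. The same dichotomy applied
to an ideal of the span \<open>S\<close> of all \<open>[\<i> P', L]\<close>, \<open>P'\<close> conjugate to \<open>P\<close>, and to its orthogonal
complement shows that \<open>S\<close> is simple. Finally \<open>S\<close> is the Lie algebra of the commutator subgroup, since
every \<open>exp [\<i> P', X]\<close> is a commutator and determinants exclude scalars.\<close>

subsection \<open>Matrix algebra\<close>

text \<open>Structure theory of compact Lie algebras is replaced by orthogonality for the trace
  form, which is invariant under unitary conjugation: for \<open>X\<close> in \<open>L\<close> the
  identity <[Z, X], W> = <Z, [X, W]> with W = [Z, X] forces [Z, X] = 0 as soon as [X, W] is
  orthogonal to Z. Behind the scalar alternative is a count: eigenvalues of commuting parts on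
  different factors add independently, so two distinct eigenvalues on each side would give at least
  three sums. As \<open>G\<close> may be disconnected, statements reach it not through exponentials
  but from the conjugates of \<open>g\<close> by products and limits. The delicate point is the last
  step: the commutator subgroup is an abstract group not known to be closed, so its set of
  one-parameter directions is not known to be a vector space. Tangent vectors are therefore taken in
  its closure, and coordinates built from one-parameter groups of the subgroup itself bring them
  back. Scalar directions must be excluded in the closure already, which is why a continuous
  function, the determinant, is used.\<close>

lemma matrix_add_rdistrib: "(A + B) ** C = A ** C + B ** (C :: 'n::finite cmat)"
  by (simp add: vec_eq_iff matrix_matrix_mult_def algebra_simps sum.distrib)

lemma matrix_diff_ldistrib: "A ** (B - C) = A ** B - A ** (C :: 'n::finite cmat)"
  by (simp add: vec_eq_iff matrix_matrix_mult_def algebra_simps sum_subtractf)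

lemma matrix_diff_rdistrib: "(A - B) ** C = A ** C - B ** (C :: 'n::finite cmat)"
  by (simp add: vec_eq_iff matrix_matrix_mult_def algebra_simps sum_subtractf)

lemma matrix_minus_left: "(- A) ** B = - (A ** (B :: 'n::finite cmat))"
  by (simp add: vec_eq_iff matrix_matrix_mult_def sum_negf)

lemma matrix_minus_right: "A ** (- B) = - (A ** (B :: 'n::finite cmat))"
  by (simp add: vec_eq_iff matrix_matrix_mult_def sum_negf)

lemma matrix_zero_left: "0 ** B = (0 :: 'n::finite cmat)"
  by (simp add: vec_eq_iff matrix_matrix_mult_def)

lemma matrix_zero_right: "B ** 0 = (0 :: 'n::finite cmat)"
  by (simp add: vec_eq_iff matrix_matrix_mult_def)

lemma matrix_scaleR_left: "(r *\<^sub>R A) ** B = r *\<^sub>R (A ** (B :: 'n::finite cmat))"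
  by (simp add: vec_eq_iff matrix_matrix_mult_def scaleR_sum_right)

lemma matrix_scaleR_right: "A ** (r *\<^sub>R B) = r *\<^sub>R (A ** (B :: 'n::finite cmat))"
  by (simp add: vec_eq_iff matrix_matrix_mult_def scaleR_sum_right)

lemmas matrix_ring_simps = matrix_mul_assoc matrix_add_ldistrib matrix_add_rdistrib
  matrix_diff_ldistrib matrix_diff_rdistrib matrix_minus_left matrix_minus_right
  matrix_zero_left matrix_zero_right matrix_scaleR_left matrix_scaleR_right

lemma mat_mult_nth: "(mat c ** A) $ i $ j = c * (A :: 'n::finite cmat) $ i $ j"
  by (simp add: matrix_matrix_mult_def mat_def if_distrib if_distribR cong: if_cong)

lemma mult_mat_nth: "(A ** mat c) $ i $ j = c * (A :: 'n::finite cmat) $ i $ j"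
  by (simp add: matrix_matrix_mult_def mat_def if_distrib if_distribR mult.commute cong: if_cong)

lemma mat_commute: "A ** mat c = mat c ** (A :: 'n::finite cmat)"
  by (simp add: vec_eq_iff mat_mult_nth mult_mat_nth)

lemma mat_mult_mat: "mat c ** mat d = (mat (c * d) :: 'n::finite cmat)"
  by (simp add: vec_eq_iff mat_mult_nth) (simp add: mat_def)

lemma mat_add: "mat (c + d) = mat c + (mat d :: 'n::finite cmat)"
  by (simp add: vec_eq_iff mat_def)

lemma mat_diff: "mat (c - d) = mat c - (mat d :: 'n::finite cmat)"
  by (simp add: vec_eq_iff mat_def)

lemma mat_minus: "mat (- c) = - (mat c :: 'n::finite cmat)"
  by (simp add: vec_eq_iff mat_def)

lemma mat_of_real: "mat (complex_of_real r) = r *\<^sub>R (mat 1 :: 'n::finite cmat)"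
  by (simp add: vec_eq_iff mat_def of_real_def)

lemma mat_of_real_mult: "mat (complex_of_real r) ** A = r *\<^sub>R (A :: 'n::finite cmat)"
  by (simp add: mat_of_real matrix_scaleR_left)

lemma mat_mult_vec: "mat c *v v = c *s (v :: complex^'n::finite)"
  by (simp add: vec_eq_iff matrix_vector_mult_def mat_def if_distrib if_distribR cong: if_cong)

lemma matrix_vector_smult: "A *v (c *s v) = c *s (A *v (v :: complex^'n::finite))"
  by (simp add: vec_eq_iff matrix_vector_mult_def sum_distrib_left mult_ac)

section \<open>Adjoints, the trace inner product and the Frobenius norm\<close>

lemma adj_nth: "adj_mat A $ i $ j = cnj (A $ j $ i)"
  by (simp add: adj_mat_def)

lemma adj_mult: "adj_mat (A ** B) = adj_mat B ** adj_mat A"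
  by (simp add: vec_eq_iff adj_nth matrix_matrix_mult_def mult.commute)

lemma adj_adj [simp]: "adj_mat (adj_mat A) = A"
  by (simp add: vec_eq_iff adj_nth)

lemma adj_mat_scalar: "adj_mat (mat c) = mat (cnj c)"
  by (simp add: vec_eq_iff adj_nth mat_def)

lemma adj_mat_1 [simp]: "adj_mat (mat 1) = mat 1"
  by (simp add: adj_mat_scalar)

lemma adj_add: "adj_mat (A + B) = adj_mat A + adj_mat B"
  by (simp add: vec_eq_iff adj_nth)

lemma adj_diff: "adj_mat (A - B) = adj_mat A - adj_mat B"
  by (simp add: vec_eq_iff adj_nth)

lemma adj_scaleR: "adj_mat (r *\<^sub>R A) = r *\<^sub>R adj_mat A"
  by (simp add: vec_eq_iff adj_nth)

text \<open>The Euclidean inner product on \<open>complex^'n\<close> is the real part of the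
  Hermitian one, so \<open>adj_mat\<close> is also the adjoint in the real sense, and real
  orthogonality arguments apply to complex matrices.\<close>

lemma inner_mult_vec: "(A *v x) \<bullet> y = x \<bullet> (adj_mat A *v (y :: complex^'n::finite))"
proof -
  have "(A *v x) \<bullet> y = (\<Sum>i\<in>UNIV. \<Sum>j\<in>UNIV. Re (A $ i $ j * x $ j * cnj (y $ i)))"
    by (simp add: inner_vec_def inner_complex_def matrix_vector_mult_def sum_distrib_right
        flip: sum.distrib)
  also have "\<dots> = (\<Sum>j\<in>UNIV. \<Sum>i\<in>UNIV. Re (A $ i $ j * x $ j * cnj (y $ i)))"
    by (rule sum.swap)
  also have "\<dots> = x \<bullet> (adj_mat A *v y)"
    by (simp add: inner_vec_def inner_complex_def matrix_vector_mult_def sum_distrib_left adj_nth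
        algebra_simps flip: sum.distrib)
  finally show ?thesis .
qed

lemma inner_cmat: "A \<bullet> B = Re (trace (A ** adj_mat (B :: 'n::finite cmat)))"
  by (simp add: inner_vec_def inner_complex_def trace_def matrix_matrix_mult_def adj_nth)

text \<open>Cyclicity of the trace. Together with its right-hand companion it makes multiplication
  by unitary matrices isometric and the form invariant under brackets.\<close>

lemma inner_cmat_mult_left: "(A ** B) \<bullet> C = B \<bullet> (adj_mat A ** (C :: 'n::finite cmat))"
proof -
  have "trace (A ** B ** adj_mat C) = trace (B ** (adj_mat C ** A))"
    by (metis matrix_mul_assoc trace_mul_sym)
  then show ?thesis
    by (simp add: inner_cmat adj_mult)
qed

lemma inner_cmat_mult_right: "(A ** B) \<bullet> C = A \<bullet> ((C :: 'n::finite cmat) ** adj_mat B)"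
  by (simp add: inner_cmat adj_mult matrix_mul_assoc)

text \<open>Each row of the product is a combination of the rows of \<open>B\<close>, bounded by
  Cauchy-Schwarz. The norm is the Frobenius norm, in which the identity has norm sqrt n; hence the
  factor \<open>norm (mat 1)\<close> in the later exponential estimates.\<close>

lemma norm_cmat_mult: "norm (A ** B) \<le> norm A * norm (B :: 'n::finite cmat)"
proof -
  have row: "norm ((A ** B) $ i) \<le> norm (A $ i) * norm B" for i
  proof -
    have "(A ** B) $ i = (\<Sum>k\<in>UNIV. A $ i $ k *s B $ k)"
      by (simp add: vec_eq_iff matrix_matrix_mult_def)
    moreover have "norm (A $ i $ k *s B $ k) = norm (A $ i $ k) * norm (B $ k)" for k
      by (simp add: norm_vec_def L2_set_right_distrib norm_mult)
    ultimately have "norm ((A ** B) $ i) \<le> (\<Sum>k\<in>UNIV. norm (A $ i $ k) * norm (B $ k))"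
      by (metis (no_types, lifting) norm_sum sum.cong)
    also have "\<dots> \<le> norm (A $ i) * norm B"
      using L2_set_mult_ineq[of "\<lambda>k. norm (A $ i $ k)" "\<lambda>k. norm (B $ k)" UNIV]
      by (simp add: norm_vec_def)
    finally show ?thesis .
  qed
  have "norm (A ** B) \<le> L2_set (\<lambda>i. norm (A $ i) * norm B) UNIV"
    unfolding norm_vec_def[of "A ** B"] by (rule L2_set_mono) (use row in auto)
  also have "\<dots> = norm A * norm B"
    by (simp add: norm_vec_def[of A] L2_set_left_distrib)
  finally show ?thesis .
qed

lemma bounded_bilinear_cmat_mult:
  "bounded_bilinear ((**) :: 'n::finite cmat \<Rightarrow> 'n cmat \<Rightarrow> 'n cmat)"
  by (rule bounded_bilinear.intro)
    (auto simp: matrix_ring_simps intro!: exI[of _ 1] norm_cmat_mult)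

lemmas tendsto_cmat_mult [tendsto_intros] =
  bounded_bilinear.tendsto[OF bounded_bilinear_cmat_mult]
lemmas continuous_on_cmat_mult [continuous_intros] =
  bounded_bilinear.continuous_on[OF bounded_bilinear_cmat_mult]
lemmas bounded_linear_cmat_mult_left = bounded_bilinear.bounded_linear_left[OF bounded_bilinear_cmat_mult]
lemmas bounded_linear_cmat_mult_right = bounded_bilinear.bounded_linear_right[OF bounded_bilinear_cmat_mult]

lemma bounded_linear_adj: "bounded_linear (adj_mat :: 'n::finite cmat \<Rightarrow> 'n cmat)"
  by (rule linear_conv_bounded_linear[THEN iffD1], rule linearI) (simp_all add: adj_add adj_scaleR)

lemmas tendsto_adj [tendsto_intros] = bounded_linear.tendsto[OF bounded_linear_adj]
lemmas continuous_on_adj [continuous_intros] = bounded_linear.continuous_on[OF bounded_linear_adj]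

lemma bounded_linear_mult_vec: "bounded_linear (\<lambda>A. A *v (v :: complex^'n::finite))"
  by (rule linear_conv_bounded_linear[THEN iffD1], rule linearI)
    (simp_all add: algebra_simps vec_eq_iff matrix_vector_mult_def scaleR_sum_right sum.distrib)

lemma bounded_linear_entry: "bounded_linear (\<lambda>A :: 'n::finite cmat. A $ i $ j)"
  by (rule linear_conv_bounded_linear[THEN iffD1], rule linearI) simp_all

section \<open>Unitary matrices and generated subgroups\<close>

lemma unitary_mult:
  assumes "unitary_mat A" "unitary_mat B"
  shows "unitary_mat (A ** B)"
proof -
  have "A ** B ** (adj_mat B ** adj_mat A) = A ** (B ** adj_mat B) ** adj_mat A"
    "adj_mat B ** adj_mat A ** (A ** B) = adj_mat B ** (adj_mat A ** A) ** B"
    by (simp_all only: matrix_mul_assoc)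
  then show ?thesis
    using assms by (simp add: unitary_mat_def adj_mult)
qed

lemma unitary_1: "unitary_mat (mat 1)"
  by (simp add: unitary_mat_def)

lemma matrix_inv_eqI:
  fixes A B :: "'n::finite cmat"
  assumes "A ** B = mat 1" "B ** A = mat 1"
  shows "invertible A" "matrix_inv A = B"
proof -
  show "invertible A"
    unfolding invertible_def using assms by blast
  then have "A ** matrix_inv A = mat 1"
    unfolding invertible_def matrix_inv_def by (rule someI2_ex) blast
  then show "matrix_inv A = B"
    by (metis assms(2) matrix_mul_assoc matrix_mul_lid matrix_mul_rid)
qed

lemma unitary_inv:
  assumes "unitary_mat A"
  shows "invertible A" "matrix_inv A = adj_mat A"
  using assms matrix_inv_eqI[of A "adj_mat A"] by (auto simp: unitary_mat_def)

lemma norm_mult_unitary: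
  assumes "unitary_mat B"
  shows "norm (A ** B) = norm (A :: 'n::finite cmat)"
proof -
  have "A ** B ** adj_mat B = A"
    using assms by (simp add: unitary_mat_def flip: matrix_mul_assoc)
  then show ?thesis
    by (simp add: norm_eq_sqrt_inner inner_cmat_mult_right)
qed

lemma norm_unitary_mult:
  assumes "unitary_mat A"
  shows "norm (A ** B) = norm (B :: 'n::finite cmat)"
proof -
  have "adj_mat A ** (A ** B) = B"
    using assms by (simp add: unitary_mat_def matrix_mul_assoc)
  then show ?thesis
    by (simp only: norm_eq_sqrt_inner inner_cmat_mult_left)
qed

lemma is_subgroup_unitaryI:
  assumes "mat 1 \<in> H" "\<And>a b. a \<in> H \<Longrightarrow> b \<in> H \<Longrightarrow> a ** b \<in> H"
    "\<And>a. a \<in> H \<Longrightarrow> adj_mat a \<in> H" "\<And>a. a \<in> H \<Longrightarrow> unitary_mat a"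
  shows "is_subgroup H"
  using assms by (auto simp: is_subgroup_def unitary_inv)

lemma gen_subgroup_least: "is_subgroup T \<Longrightarrow> S \<subseteq> T \<Longrightarrow> gen_subgroup S \<subseteq> T"
  unfolding gen_subgroup_def by (rule Inter_lower) simp

lemma gen_subgroup_superset: "S \<subseteq> gen_subgroup S"
  by (auto simp: gen_subgroup_def)

lemma in_gen_subgroup_iff: "a \<in> gen_subgroup S \<longleftrightarrow> (\<forall>H. is_subgroup H \<and> S \<subseteq> H \<longrightarrow> a \<in> H)"
  by (simp add: gen_subgroup_def)

text \<open>The ambient subgroup \<open>T\<close> keeps the intersected family nonempty; an empty
  intersection would consist of all matrices, singular ones included.\<close>

lemma is_subgroup_gen_subgroup:
  assumes "is_subgroup T" "S \<subseteq> T"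
  shows "is_subgroup (gen_subgroup S)"
  unfolding is_subgroup_def[of "gen_subgroup S"]
proof (intro conjI ballI)
  fix a assume "a \<in> gen_subgroup S"
  then have "a \<in> T"
    using assms by (simp add: in_gen_subgroup_iff)
  then show "invertible a"
    using assms by (simp add: is_subgroup_def)
qed (simp_all add: in_gen_subgroup_iff is_subgroup_def)

subsection \<open>Matrix exponential\<close>

lemma norm_matpow: "norm (matpow A k) \<le> norm (mat 1 :: 'n::finite cmat) * norm (A :: 'n cmat) ^ k"
proof (induction k)
  case (Suc k)
  have "norm (matpow A (Suc k)) \<le> norm A * norm (matpow A k)"
    by (simp add: norm_cmat_mult)
  also have "\<dots> \<le> norm A * (norm (mat 1 :: 'n cmat) * norm A ^ k)"
    by (intro mult_left_mono Suc) simp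
  finally show ?case
    by (simp add: mult_ac)
qed simp

lemma matpow_commute: "A ** B = B ** A \<Longrightarrow> matpow A k ** B = B ** matpow A k"
proof (induction k)
  case (Suc k)
  have "matpow A (Suc k) ** B = A ** (matpow A k ** B)"
    by (simp add: matrix_mul_assoc)
  also have "\<dots> = A ** B ** matpow A k"
    using Suc by (simp add: matrix_mul_assoc)
  also have "\<dots> = B ** matpow A (Suc k)"
    using Suc by (simp add: matrix_mul_assoc)
  finally show ?case .
qed simp

lemma matpow_conj:
  fixes U V :: "'n::finite cmat"
  assumes "V ** U = mat 1" "U ** V = mat 1"
  shows "matpow (U ** A ** V) k = U ** matpow A k ** V"
proof (induction k)
  case (Suc k)
  have "matpow (U ** A ** V) (Suc k) = U ** A ** (V ** U) ** matpow A k ** V"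
    using Suc by (simp only: matpow.simps matrix_mul_assoc)
  then show ?case
    using assms by (simp add: matrix_mul_assoc)
qed (use assms in simp)

lemma matpow_adj: "matpow (adj_mat A) k = adj_mat (matpow A k)"
proof (induction k)
  case (Suc k)
  have "adj_mat A ** adj_mat (matpow A k) = adj_mat (matpow A k ** A)"
    by (simp add: adj_mult)
  then show ?case
    using Suc matpow_commute[of A A k] by simp
qed simp

lemma continuous_on_matpow [continuous_intros]: "continuous_on S (\<lambda>A :: 'n::finite cmat. matpow A k)"
  by (induction k) (auto intro!: continuous_intros)

definition expterm :: "'n::finite cmat \<Rightarrow> nat \<Rightarrow> 'n cmat" where
  "expterm A k = (1 / fact k) *\<^sub>R matpow A k"

lemma norm_expterm: "norm (expterm (A :: 'n::finite cmat) k) \<le> norm (mat 1 :: 'n cmat) * (inverse (fact k) * norm A ^ k)"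
  using mult_left_mono[OF norm_matpow[of A k], of "inverse (fact k)"]
  by (simp add: expterm_def field_simps)

lemma summable_norm_expterm: "summable (\<lambda>k. norm (expterm A k))"
  by (rule summable_comparison_test'[OF summable_mult[OF summable_exp]]) (auto intro: norm_expterm)

lemma expterm_sums: "expterm A sums mexp A"
  using summable_norm_cancel[OF summable_norm_expterm[of A]]
  by (simp add: mexp_def summable_sums expterm_def[abs_def])

lemma expterm_Suc: "real (Suc n) *\<^sub>R expterm A (Suc n) = A ** expterm A n"
  by (simp add: expterm_def matrix_scaleR_right del: of_nat_Suc)

text \<open>Binomial theorem in divided powers. After multiplication by n + 1, the factors
  \<open>A\<close> and \<open>B\<close> raise one index each and produce the weights i and n + 1 -
  i, which add up to n + 1; binomial coefficients never appear.\<close>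

lemma expterm_add_commuting:
  fixes A B :: "'n::finite cmat"
  assumes AB: "A ** B = B ** A"
  shows "expterm (A + B) n = (\<Sum>i\<le>n. expterm A i ** expterm B (n - i))"
proof (induction n)
  case 0
  show ?case by (simp add: expterm_def)
next
  case (Suc n)
  let ?f = "\<lambda>i. expterm A i ** expterm B (Suc n - i)"
  have comm: "B ** expterm A i = expterm A i ** B" for i
    using matpow_commute[OF AB] by (simp add: expterm_def matrix_scaleR_left matrix_scaleR_right)
  have msum: "C ** (\<Sum>i\<le>n. F i) = (\<Sum>i\<le>n. C ** F i)" for C :: "'n cmat" and F :: "nat \<Rightarrow> 'n cmat"
    by (rule linear_sum[OF bounded_linear.linear[OF bounded_linear_cmat_mult_right]])
  have "real (Suc n) *\<^sub>R expterm (A + B) (Suc n) =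
      (\<Sum>i\<le>n. A ** (expterm A i ** expterm B (n - i))) + (\<Sum>i\<le>n. B ** (expterm A i ** expterm B (n - i)))"
    by (simp only: expterm_Suc Suc matrix_add_rdistrib msum sum.distrib)
  also have "(\<Sum>i\<le>n. A ** (expterm A i ** expterm B (n - i))) = (\<Sum>i\<le>n. real (Suc i) *\<^sub>R ?f (Suc i))"
    by (intro sum.cong refl)
      (simp add: matrix_mul_assoc matrix_scaleR_left flip: expterm_Suc del: of_nat_Suc)
  also have "\<dots> = (\<Sum>i\<le>Suc n. real i *\<^sub>R ?f i)"
    by (subst sum.atMost_Suc_shift) simp
  also have "(\<Sum>i\<le>n. B ** (expterm A i ** expterm B (n - i))) = (\<Sum>i\<le>n. real (Suc n - i) *\<^sub>R ?f i)"
  proof (intro sum.cong refl)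
    fix i assume "i \<in> {..n}"
    then have *: "Suc n - i = Suc (n - i)"
      by auto
    have "B ** (expterm A i ** expterm B (n - i)) = expterm A i ** (B ** expterm B (n - i))"
      by (simp only: matrix_mul_assoc comm)
    also have "\<dots> = real (Suc n - i) *\<^sub>R ?f i"
      by (simp only: * matrix_scaleR_right flip: expterm_Suc)
    finally show "B ** (expterm A i ** expterm B (n - i)) = real (Suc n - i) *\<^sub>R ?f i" .
  qed
  also have "\<dots> = (\<Sum>i\<le>Suc n. real (Suc n - i) *\<^sub>R ?f i)"
    by simp
  also have "(\<Sum>i\<le>Suc n. real i *\<^sub>R ?f i) + (\<Sum>i\<le>Suc n. real (Suc n - i) *\<^sub>R ?f i)
      = (\<Sum>i\<le>Suc n. real (Suc n) *\<^sub>R ?f i)"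
    unfolding sum.distrib[symmetric] scaleR_add_left[symmetric] of_nat_add[symmetric]
    by (intro sum.cong refl) simp
  finally have "real (Suc n) *\<^sub>R expterm (A + B) (Suc n) = real (Suc n) *\<^sub>R (\<Sum>i\<le>Suc n. ?f i)"
    by (simp only: scaleR_right.sum)
  then show ?case
    by (simp del: sum.atMost_Suc)
qed

text \<open>The Cauchy product is formed for the scalar series of the entries, which converge
  absolutely because entries are dominated by the matrix norm.\<close>

lemma mexp_add_commuting:
  fixes A B :: "'n::finite cmat"
  assumes AB: "A ** B = B ** A"
  shows "mexp (A + B) = mexp A ** mexp B"
proof -
  have entry: "(\<lambda>k. expterm C k $ i $ j) sums (mexp C $ i $ j)" for C :: "'n cmat" and i j
    by (rule bounded_linear.sums[OF bounded_linear_entry expterm_sums])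
  have norm_entry: "summable (\<lambda>k. norm (expterm C k $ i $ j))" for C :: "'n cmat" and i j
    by (rule summable_comparison_test'[OF summable_norm_expterm[of C]])
      (metis Finite_Cartesian_Product.norm_nth_le norm_ge_zero order.trans real_norm_def abs_of_nonneg)
  have "mexp (A + B) $ i $ j = (mexp A ** mexp B) $ i $ j" for i j
  proof (rule sums_unique2[OF entry])
    have "(\<lambda>k. \<Sum>m\<le>k. expterm A m $ i $ l * expterm B (k - m) $ l $ j) sums (mexp A $ i $ l * mexp B $ l $ j)" for l
      using Cauchy_product_sums[OF norm_entry[of A i l] norm_entry[of B l j]]
      by (simp add: sums_unique[OF entry, symmetric])
    then have "(\<lambda>k. \<Sum>l\<in>UNIV. \<Sum>m\<le>k. expterm A m $ i $ l * expterm B (k - m) $ l $ j)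
        sums (\<Sum>l\<in>UNIV. mexp A $ i $ l * mexp B $ l $ j)"
      by (intro sums_sum)
    moreover have "(\<Sum>l\<in>UNIV. \<Sum>m\<le>k. expterm A m $ i $ l * expterm B (k - m) $ l $ j) = expterm (A + B) k $ i $ j" for k
      by (subst sum.swap) (simp add: expterm_add_commuting[OF AB] matrix_matrix_mult_def)
    ultimately show "(\<lambda>k. expterm (A + B) k $ i $ j) sums (mexp A ** mexp B) $ i $ j"
      by (simp add: matrix_matrix_mult_def)
  qed
  then show ?thesis
    by (simp add: vec_eq_iff)
qed

lemma mexp_0 [simp]: "mexp (0 :: 'n::finite cmat) = mat 1"
proof -
  have "matpow 0 k = (if k = 0 then mat 1 else (0 :: 'n cmat))" for k
    by (cases k) (auto simp: matrix_zero_left)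
  then have "expterm 0 = (\<lambda>k. if k = 0 then mat 1 else (0 :: 'n cmat))"
    by (simp add: expterm_def fun_eq_iff)
  then show ?thesis
    using expterm_sums[of 0] sums_single[of 0 "\<lambda>_. mat 1"] by (metis (mono_tags, lifting) sums_cong sums_unique2)
qed

lemma mexp_minus_right: "mexp A ** mexp (- A) = mat 1"
  using mexp_add_commuting[of A "- A"] by (simp add: matrix_ring_simps)

lemma mexp_minus_left: "mexp (- A) ** mexp A = mat 1"
  using mexp_minus_right[of "- A"] by simp

lemma matrix_inv_mexp: "matrix_inv (mexp A) = mexp (- A)"
  by (rule matrix_inv_eqI[OF mexp_minus_right mexp_minus_left])

lemma mexp_conj:
  fixes U V :: "'n::finite cmat"
  assumes "V ** U = mat 1" "U ** V = mat 1"
  shows "mexp (U ** A ** V) = U ** mexp A ** V"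
proof -
  have "bounded_linear (\<lambda>X. U ** X ** V)"
    by (rule bounded_linear_compose[OF bounded_linear_cmat_mult_left[of V] bounded_linear_cmat_mult_right[of U]])
  then have "(\<lambda>k. U ** expterm A k ** V) sums (U ** mexp A ** V)"
    by (rule bounded_linear.sums[OF _ expterm_sums])
  moreover have "U ** expterm A k ** V = expterm (U ** A ** V) k" for k
    by (simp add: expterm_def matpow_conj[OF assms] matrix_scaleR_left matrix_scaleR_right)
  ultimately have "expterm (U ** A ** V) sums (U ** mexp A ** V)"
    by simp
  then show ?thesis
    using expterm_sums sums_unique2 by blast
qed

lemma mexp_adj: "adj_mat (mexp A) = mexp (adj_mat A)"
proof -
  have "(\<lambda>k. adj_mat (expterm A k)) sums adj_mat (mexp A)"
    by (rule bounded_linear.sums[OF bounded_linear_adj expterm_sums])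
  then have "expterm (adj_mat A) sums adj_mat (mexp A)"
    by (simp add: expterm_def[abs_def] adj_scaleR matpow_adj)
  then show ?thesis
    using expterm_sums sums_unique2 by blast
qed

lemma unitary_mexp: "adj_mat A = - A \<Longrightarrow> unitary_mat (mexp A)"
  by (simp add: unitary_mat_def mexp_adj mexp_minus_right mexp_minus_left)

lemma mexp_mult_nat: "matpow (mexp A) k = mexp (real k *\<^sub>R A)"
proof (induction k)
  case (Suc k)
  have "mexp (A + real k *\<^sub>R A) = mexp A ** mexp (real k *\<^sub>R A)"
    by (rule mexp_add_commuting) (simp add: matrix_ring_simps)
  then show ?case
    using Suc by (simp add: algebra_simps)
qed simp

lemma mexp_idempotent:
  fixes P :: "'n::finite cmat"
  assumes "P ** P = P"
  shows "mexp (mat z ** P) = mat 1 + mat (exp z - 1) ** P"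
proof -
  have pow: "matpow (mat z ** P) (Suc k) = mat (z ^ Suc k) ** P" for k
  proof (induction k)
    case (Suc k)
    have "matpow (mat z ** P) (Suc (Suc k)) = mat z ** P ** (mat (z ^ Suc k) ** P)"
      using Suc by simp
    also have "\<dots> = mat z ** (P ** mat (z ^ Suc k)) ** P"
      by (simp only: matrix_mul_assoc)
    also have "\<dots> = mat (z ^ Suc (Suc k)) ** (P ** P)"
      by (simp only: mat_commute[of P] matrix_mul_assoc mat_mult_mat power_Suc)
    finally show ?case
      using assms by simp
  qed simp
  \<comment> \<open>All powers of \<open>P\<close> except the zeroth equal \<open>P\<close>. Writing
    the series as exp z times \<open>P\<close> therefore needs the correction
    \<open>mat 1 - P\<close> in degree 0.\<close>
  have coeff: "expterm (mat z ** P) k = (if k = 0 then mat 1 - P else 0) + mat (z ^ k /\<^sub>R fact k) ** P" for k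
  proof (cases k)
    case (Suc m)
    have "r *\<^sub>R (mat c ** P) = mat (r *\<^sub>R c) ** P" for r c
      by (simp add: vec_eq_iff mat_mult_nth)
    then show ?thesis
      using Suc by (simp add: expterm_def pow inverse_eq_divide del: matpow.simps fact_Suc power_Suc)
  qed (simp add: expterm_def)
  have bl: "bounded_linear (\<lambda>c. mat c ** P)"
    by (rule linear_conv_bounded_linear[THEN iffD1], rule linearI)
      (simp_all add: vec_eq_iff mat_mult_nth distrib_right)
  have "expterm (mat z ** P) sums ((mat 1 - P) + mat (exp z) ** P)"
    unfolding coeff[abs_def]
    by (intro sums_add sums_single[of 0 "\<lambda>_. mat 1 - P"] bounded_linear.sums[OF bl exp_converges])
  then have "mexp (mat z ** P) = (mat 1 - P) + mat (exp z) ** P"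
    using expterm_sums sums_unique2 by blast
  then show ?thesis
    by (simp add: mat_diff matrix_diff_rdistrib)
qed

lemma mexp_mat: "mexp (mat z) = mat (exp z)"
  using mexp_idempotent[of "mat 1" z] by (simp add: mat_diff)

text \<open>The tail from degree 2 is compared with the exponential series through 1/(k + 2)! \<le>
  1/k!. The quadratic order of the remainder is what yields the derivative at 0 and the limits of
  difference quotients.\<close>

lemma mexp_bound:
  "norm (mexp A - mat 1 - A) \<le> norm (mat 1 :: 'n::finite cmat) * norm (A :: 'n cmat) ^ 2 * exp (norm A)"
proof -
  let ?c = "norm (mat 1 :: 'n cmat)"
  let ?g = "\<lambda>k. ?c * norm A ^ 2 * (norm A ^ k /\<^sub>R fact k)"
  have "mexp A = (\<Sum>k. expterm A (k + 2)) + (\<Sum>k<2. expterm A k)"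
    using suminf_split_initial_segment[OF sums_summable[OF expterm_sums], of A 2]
    by (simp add: sums_unique[OF expterm_sums])
  then have eq: "mexp A - mat 1 - A = (\<Sum>k. expterm A (k + 2))"
    by (simp add: numeral_2_eq_2 expterm_def)
  have g: "?g sums (?c * norm A ^ 2 * exp (norm A))"
    by (intro sums_mult exp_converges)
  have le: "norm (expterm A (k + 2)) \<le> ?g k" for k
  proof -
    have "norm (expterm A (k + 2)) \<le> ?c * (inverse (fact (k + 2)) * norm A ^ (k + 2))"
      by (rule norm_expterm)
    also have "\<dots> \<le> ?c * (inverse (fact k) * norm A ^ (k + 2))"
      by (intro mult_left_mono mult_right_mono le_imp_inverse_le fact_mono) auto
    finally show ?thesis
      by (simp add: power_add power2_eq_square mult_ac)
  qed
  have "norm (\<Sum>k. expterm A (k + 2)) \<le> (\<Sum>k. ?g k)"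
    by (rule norm_suminf_le[OF le sums_summable[OF g]])
  then show ?thesis
    using eq sums_unique[OF g] by simp
qed

lemma has_derivative_mexp_0: "(mexp has_derivative (\<lambda>A. A)) (at (0 :: 'n::finite cmat))"
proof (rule has_derivativeI_sandwich[of 1])
  let ?c = "norm (mat 1 :: 'n cmat)"
  fix A :: "'n cmat"
  assume "A \<noteq> 0"
  then show "norm (mexp A - mexp 0 - (A - 0)) / norm (A - 0) \<le> ?c * norm A * exp (norm A)"
    using mexp_bound[of A] by (simp add: divide_le_eq power2_eq_square mult_ac)
next
  show "((\<lambda>A. norm (mat 1 :: 'n cmat) * norm A * exp (norm A)) \<longlongrightarrow> 0) (at (0::'n cmat))"
    by (auto intro!: tendsto_eq_intros)
qed auto

text \<open>The partial sums converge uniformly on every ball by the Weierstrass test, and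
  continuity is local.\<close>

lemma continuous_on_mexp: "continuous_on S (mexp :: 'n::finite cmat \<Rightarrow> 'n cmat)"
proof -
  have "continuous_on (ball 0 r) (mexp :: 'n cmat \<Rightarrow> 'n cmat)" if "r > 0" for r
  proof (rule uniform_limit_theorem)
    let ?M = "\<lambda>k. norm (mat 1 :: 'n cmat) * (inverse (fact k) * r ^ k)"
    show "uniform_limit (ball 0 r) (\<lambda>n A. \<Sum>k<n. expterm A k) (mexp :: 'n cmat \<Rightarrow> 'n cmat) sequentially"
      unfolding mexp_def[abs_def] expterm_def[symmetric]
    proof (rule Weierstrass_m_test)
      fix n and A :: "'n cmat"
      assume "A \<in> ball 0 r"
      then have "?M n \<ge> norm (mat 1 :: 'n cmat) * (inverse (fact n) * norm A ^ n)"
        by (intro mult_left_mono power_mono) auto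
      then show "norm (expterm A n) \<le> ?M n"
        using norm_expterm[of A n] by linarith
    next
      show "summable ?M"
        by (intro summable_mult summable_exp)
    qed
    show "\<forall>\<^sub>F n in sequentially. continuous_on (ball 0 r) (\<lambda>A :: 'n cmat. \<Sum>k<n. expterm A k)"
      unfolding expterm_def by (intro always_eventually allI continuous_intros)
  qed simp
  then have "continuous (at A) (mexp :: 'n cmat \<Rightarrow> 'n cmat)" for A
    using continuous_on_eq_continuous_at[of "ball 0 (norm A + 1)"]
    by (metis add_nonneg_pos less_add_one mem_ball_0 norm_ge_zero open_ball zero_less_one)
  then show ?thesis
    by (simp add: continuous_at_imp_continuous_on)
qed

lemmas continuous_on_mexp' [continuous_intros] = continuous_on_compose2[OF continuous_on_mexp[of UNIV] _ subset_UNIV]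

subsection \<open>Eigenvectors and irreducibility\<close>

lemma complex_subspace_imp_subspace:
  fixes W :: "(complex^'n::finite) set"
  assumes "complex_subspace W"
  shows "subspace W"
proof -
  have "c *\<^sub>R x = complex_of_real c *s x" for c and x :: "complex^'n"
    by (simp add: vec_eq_iff) (simp add: scaleR_conv_of_real)
  then show ?thesis
    using assms by (simp add: complex_subspace_def subspace_def)
qed

lemma complex_subspace_kernel: "complex_subspace {v. A *v v = 0}"
  by (simp add: complex_subspace_def matrix_vector_right_distrib matrix_vector_smult)

lemma complex_subspace_UNIV: "complex_subspace UNIV"
  by (simp add: complex_subspace_def)

lemma complex_subspace_Int: "complex_subspace V \<Longrightarrow> complex_subspace W \<Longrightarrow> complex_subspace (V \<inter> W)"
  by (simp add: complex_subspace_def)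

lemma mult_vec_kernel_eq: "(A - mat c) *v v = 0 \<longleftrightarrow> A *v v = c *s (v :: complex^'n::finite)"
  by (simp add: matrix_vector_mult_diff_rdistrib mat_mult_vec)

lemma complex_subspace_eigenspace: "complex_subspace {v. A *v v = c *s v}"
  using complex_subspace_kernel[of "A - mat c"] by (simp add: mult_vec_kernel_eq)

lemma matrix_vector_minus_left: "(- A) *v v = - (A *v (v :: complex^'n::finite))"
  by (simp add: vec_eq_iff matrix_vector_mult_def sum_negf)

lemma cmat_eqI: "(\<And>v. A *v v = B *v v) \<Longrightarrow> A = (B :: 'n::finite cmat)"
  by (simp add: matrix_eq)

lemma commute_vec: "A ** B = B ** A \<Longrightarrow> A *v (B *v v) = B *v (A *v v)"
  by (simp add: matrix_vector_mul_assoc)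

text \<open>The first-order condition at a maximum, without derivatives: a linear term bounded by a
  quadratic one for both signs of s must vanish.\<close>

lemma linear_coeff_zero:
  fixes b c :: real
  assumes "\<And>s. 2 * s * b \<le> s * s * c"
  shows "b = 0"
proof (rule ccontr)
  assume "b \<noteq> 0"
  then have b: "b * b > 0"
    by (simp add: zero_less_mult_iff) linarith
  \<comment> \<open>With this scale, \<open>?r * c\<close> is below 1, while the choice s =
    \<open>b * ?r\<close> would force it to be at least 2.\<close>
  let ?r = "1 / (1 + \<bar>c\<bar>)"
  have r: "?r > 0"
    by simp
  have "(b * b * ?r) * 2 \<le> (b * b * ?r) * (?r * c)"
    using assms[of "b * ?r"] by (simp only: mult_ac)
  then have "2 \<le> ?r * c"
    using mult_pos_pos[OF b r] by (simp only: mult_le_cancel_left_pos)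
  then show False
    by (simp add: field_simps)
qed

text \<open>The eigenvector maximises the Rayleigh quotient on the unit sphere of \<open>W\<close>.\<close>

lemma selfadjoint_eigenvector:
  fixes T :: "'a::euclidean_space \<Rightarrow> 'a"
  assumes T: "linear T" and W: "subspace W" "W \<noteq> {0}" "\<And>w. w \<in> W \<Longrightarrow> T w \<in> W"
    and sym: "\<And>x y. x \<in> W \<Longrightarrow> y \<in> W \<Longrightarrow> T x \<bullet> y = x \<bullet> T y"
  shows "\<exists>t. \<exists>v\<in>W. v \<noteq> 0 \<and> T v = t *\<^sub>R v"
proof -
  let ?S = "W \<inter> sphere 0 1"
  obtain w where w: "w \<in> W" "w \<noteq> 0"
    using W subspace_0 by blast
  then have "(1 / norm w) *\<^sub>R w \<in> ?S"
    using W by (simp add: subspace_scale)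
  moreover have "compact ?S"
    using closed_subspace[OF W(1)] by (simp add: closed_Int_compact)
  moreover have "continuous_on ?S (\<lambda>v. T v \<bullet> v)"
    using T by (intro continuous_intros linear_continuous_on) (simp add: linear_conv_bounded_linear)
  ultimately obtain v where v: "v \<in> ?S" and max: "\<And>x. x \<in> ?S \<Longrightarrow> T x \<bullet> x \<le> T v \<bullet> v"
    using continuous_attains_sup[of ?S "\<lambda>v. T v \<bullet> v"] by blast
  define t where "t = T v \<bullet> v"
  have le: "T x \<bullet> x \<le> t * (x \<bullet> x)" if "x \<in> W" for x
  proof (cases "x = 0")
    case False
    let ?r = "1 / norm x"
    have "T (?r *\<^sub>R x) \<bullet> (?r *\<^sub>R x) \<le> t"
      using False that W unfolding t_def by (intro max) (simp add: subspace_scale)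
    then have "?r * ?r * (T x \<bullet> x) \<le> t"
      by (simp add: linear_cmul[OF T] mult.assoc)
    then show ?thesis
      using False by (simp add: field_simps dot_square_norm power2_eq_square)
  qed (simp add: linear_0[OF T])
  \<comment> \<open>The maximiser \<open>v\<close> is compared with v + s y for all real s; only the
    term linear in s matters.\<close>
  have ort: "(T v - t *\<^sub>R v) \<bullet> y = 0" if y: "y \<in> W" for y
  proof -
    let ?b = "(T v - t *\<^sub>R v) \<bullet> y" and ?c = "t * (y \<bullet> y) - T y \<bullet> y"
    have vW: "v \<in> W" "v \<bullet> v = 1"
      using v by (auto simp: dot_square_norm)
    have quad: "2 * s * ?b \<le> s * s * ?c" for s
    proof -
      have "v + s *\<^sub>R y \<in> W"
        using vW y W by (simp add: subspace_add subspace_scale)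
      from le[OF this] have "T v \<bullet> v + s * (T v \<bullet> y) + s * (T y \<bullet> v) + s * s * (T y \<bullet> y)
          \<le> t * (1 + 2 * s * (v \<bullet> y) + s * s * (y \<bullet> y))"
        by (simp add: linear_add[OF T] linear_cmul[OF T] inner_left_distrib inner_right_distrib vW
            inner_commute[of y v] algebra_simps)
      moreover have "T y \<bullet> v = T v \<bullet> y"
        using sym[OF y vW(1)] by (simp add: inner_commute)
      ultimately show ?thesis
        by (simp add: t_def[symmetric] inner_diff_left algebra_simps)
    qed
    then show ?thesis
      by (rule linear_coeff_zero)
  qed
  have "T v - t *\<^sub>R v \<in> W"
    using v W by (simp add: subspace_diff subspace_scale)
  then have "T v = t *\<^sub>R v"
    using ort[of "T v - t *\<^sub>R v"] by simp
  moreover have "v \<in> W" "v \<noteq> 0"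
    using v by auto
  ultimately show ?thesis
    by blast
qed

lemma hermitian_eigenvector:
  fixes H :: "'n::finite cmat"
  assumes H: "adj_mat H = H" and W: "complex_subspace W" "W \<noteq> {0}" "\<And>w. w \<in> W \<Longrightarrow> H *v w \<in> W"
  shows "\<exists>t v. v \<in> W \<and> v \<noteq> 0 \<and> H *v v = complex_of_real t *s v"
proof -
  have "\<exists>t. \<exists>v\<in>W. v \<noteq> 0 \<and> H *v v = t *\<^sub>R v"
    by (rule selfadjoint_eigenvector)
      (use assms in \<open>auto simp: complex_subspace_imp_subspace inner_mult_vec\<close>)
  moreover have "t *\<^sub>R v = complex_of_real t *s v" for t and v :: "complex^'n"
    by (simp add: vec_eq_iff) (simp add: scaleR_conv_of_real)
  ultimately show ?thesis
    by metis
qed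

text \<open>Multiplication by \<i> makes \<open>Y\<close> Hermitian, and a real eigenvalue t of the
  result gives the eigenvalue - \<i> t of \<open>Y\<close>.\<close>

lemma skew_eigenvector:
  fixes Y :: "'n::finite cmat"
  assumes Y: "adj_mat Y = - Y" and W: "complex_subspace W" "W \<noteq> {0}" "\<And>w. w \<in> W \<Longrightarrow> Y *v w \<in> W"
  shows "\<exists>c v. v \<in> W \<and> v \<noteq> 0 \<and> Y *v v = c *s v"
proof -
  have "adj_mat (mat \<i> ** Y) = mat \<i> ** Y"
    by (simp add: adj_mult Y adj_mat_scalar mat_minus matrix_ring_simps mat_commute)
  moreover have iY: "(mat \<i> ** Y) *v w = \<i> *s (Y *v w)" for w
    by (simp add: mat_mult_vec flip: matrix_vector_mul_assoc)
  moreover have "\<And>w. w \<in> W \<Longrightarrow> (mat \<i> ** Y) *v w \<in> W"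
    using W by (simp add: iY complex_subspace_def)
  ultimately obtain t v where tv: "v \<in> W" "v \<noteq> 0" "\<i> *s (Y *v v) = complex_of_real t *s v"
    using hermitian_eigenvector[of "mat \<i> ** Y" W] W by auto
  have "Y *v v = - \<i> *s (\<i> *s (Y *v v))"
    by (simp add: vec_eq_iff flip: mult.assoc)
  also have "\<dots> = (- \<i> * t) *s v"
    by (simp add: tv)
  finally show ?thesis
    using tv by blast
qed

text \<open>The complement is taken for the real inner product. Since \<open>W\<close> is closed
  under complex scalars, it is the Hermitian complement.\<close>

lemma complex_subspace_orthogonal:
  fixes W :: "(complex^'n::finite) set"
  assumes "complex_subspace W"
  shows "complex_subspace {v. \<forall>w\<in>W. v \<bullet> w = 0}"
proof -
  have *: "(c *s v) \<bullet> w = v \<bullet> (cnj c *s w)" for c and v w :: "complex^'n"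
    using inner_mult_vec[of "mat c" v w] by (simp add: mat_mult_vec adj_mat_scalar)
  then show ?thesis
    using assms by (simp add: complex_subspace_def inner_left_distrib)
qed

lemma orthogonal_complement_nontrivial:
  fixes W :: "'a::euclidean_space set"
  assumes "subspace W" "W \<noteq> UNIV"
  shows "{v. \<forall>w\<in>W. v \<bullet> w = 0} \<noteq> {0}"
proof -
  obtain x where x: "x \<notin> W"
    using assms by blast
  obtain y z where yz: "y \<in> span W" "\<And>w. w \<in> span W \<Longrightarrow> orthogonal z w" "x = y + z"
    using orthogonal_subspace_decomp_exists by blast
  then have "z \<noteq> 0"
    using x assms by (auto simp: span_eq_iff[THEN iffD2])
  then show ?thesis
    using yz assms by (auto simp: orthogonal_def span_base)
qed

text \<open>The orthogonal complement of one eigenspace is nonzero and stable because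
  \<open>Y\<close> is skew. An eigenvector found there has another eigenvalue, as otherwise it would
  be orthogonal to itself.\<close>

lemma skew_nonscalar_two_eigenvalues:
  fixes Y :: "'n::finite cmat"
  assumes Y: "adj_mat Y = - Y" and ns: "\<And>c. Y \<noteq> mat c"
  shows "\<exists>a b v w. a \<noteq> b \<and> v \<noteq> 0 \<and> w \<noteq> 0 \<and> Y *v v = a *s v \<and> Y *v w = b *s w"
proof -
  obtain a v where v: "v \<noteq> 0" "Y *v v = a *s v"
    using skew_eigenvector[OF Y complex_subspace_UNIV] UNIV_not_singleton
    by (metis UNIV_I vector_space_over_itself.scale_left_imp_eq)
  let ?E = "{x. Y *v x = a *s x}"
  let ?W = "{x. \<forall>w\<in>?E. x \<bullet> w = 0}"
  have E: "complex_subspace ?E"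
    by (rule complex_subspace_eigenspace)
  have "?E \<noteq> UNIV"
  proof
    assume "?E = UNIV"
    then have "Y = mat a"
      by (intro cmat_eqI) (auto simp: mat_mult_vec)
    then show False
      using ns by blast
  qed
  then have nz: "?W \<noteq> {0}"
    by (intro orthogonal_complement_nontrivial complex_subspace_imp_subspace[OF E])
  have "Y *v x \<in> ?W" if "x \<in> ?W" for x
  proof -
    have "(Y *v x) \<bullet> w = - (x \<bullet> (Y *v w))" for w
      by (simp add: inner_mult_vec Y matrix_vector_minus_left)
    moreover have "Y *v w \<in> ?E" if "w \<in> ?E" for w
      using that by (simp add: matrix_vector_smult)
    ultimately show ?thesis
      using that by simp
  qed
  then obtain b w where w: "w \<in> ?W" "w \<noteq> 0" "Y *v w = b *s w"
    using skew_eigenvector[OF Y complex_subspace_orthogonal[OF E] nz] by blast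
  then have "a \<noteq> b"
    by auto
  then show ?thesis
    using v w by blast
qed

text \<open>Schur's lemma: an eigenspace of \<open>X\<close> is stable under the commuting family,
  and a second eigenvalue would make it a proper nonzero subspace.\<close>

lemma schur_skew:
  fixes X :: "'n::finite cmat"
  assumes irr: "irreducible_rep S" and X: "adj_mat X = - X" and comm: "\<And>A. A \<in> S \<Longrightarrow> A ** X = X ** A"
  shows "\<exists>c. X = mat c"
proof (rule ccontr)
  assume "\<nexists>c. X = mat c"
  then obtain a b v w where ab: "a \<noteq> b" "v \<noteq> 0" "w \<noteq> 0" "X *v v = a *s v" "X *v w = b *s w"
    using skew_nonscalar_two_eigenvalues[OF X] by blast
  let ?E = "{x. X *v x = a *s x}"
  have "?E = {0} \<or> ?E = UNIV"
    using irr unfolding irreducible_rep_def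
  proof (elim allE[of _ ?E] impE, intro conjI ballI complex_subspace_eigenspace)
    fix A x assume "A \<in> S" "x \<in> ?E"
    then show "A *v x \<in> ?E"
      using commute_vec[OF comm[of A, symmetric], of x] by (simp add: matrix_vector_smult)
  qed
  then have "w \<in> ?E"
    using ab by (metis (mono_tags, lifting) UNIV_I empty_iff insert_iff mem_Collect_eq)
  then have "(a - b) *s w = 0"
    using ab by (simp add: vector_sub_rdistrib)
  then show False
    using ab by simp
qed

text \<open>On the eigenspace of \<open>Y\<close> for \<open>a\<close> the quadratic relation becomes a polynomial relation for
  \<open>Z\<close>, which irreducibility spreads to the whole space; two different \<open>a\<close> make it linear.\<close>

lemma commuting_sum_scalar:
  fixes Y Z :: "'n::finite cmat"
  assumes irr: "irreducible_rep (S \<union> T)"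
    and ST: "\<And>A B. A \<in> S \<Longrightarrow> B \<in> T \<Longrightarrow> A ** B = B ** A"
    and YT: "\<And>B. B \<in> T \<Longrightarrow> Y ** B = B ** Y"
    and ZS: "\<And>A. A \<in> S \<Longrightarrow> Z ** A = A ** Z"
    and YZ: "Y ** Z = Z ** Y"
    and Y: "adj_mat Y = - Y"
    and quad: "(Y + Z) ** (Y + Z) = mat \<i> ** (Y + Z)"
  shows "(\<exists>c. Y = mat c) \<or> (\<exists>c. Z = mat c)"
proof (cases "\<exists>c. Y = mat c")
  case False
  \<comment> \<open>This is (a + Z)(a + Z) - \<i> (a + Z), the quadratic relation with
    \<open>Y\<close> replaced by its eigenvalue a.\<close>
  let ?q = "\<lambda>a. mat (a * a - \<i> * a) + mat (2 * a - \<i>) ** Z + Z ** Z"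
  have q0: "?q a = 0" if v: "v \<noteq> 0" "Y *v v = a *s v" for a v
  proof -
    let ?E = "{x. Y *v x = a *s x}"
    let ?stable = "\<lambda>W. complex_subspace W \<and> (\<forall>A\<in>S. \<forall>w\<in>W. A *v w \<in> W) \<and> ?E \<subseteq> W"
    \<comment> \<open>\<open>M\<close> is the \<open>S\<close>-stable subspace generated by the
      eigenspace. Elements of \<open>T\<close> preserve the eigenspace and commute with
      \<open>S\<close>, so the vectors of \<open>M\<close> that \<open>T\<close> keeps in
      \<open>M\<close> again form such a subspace; minimality makes \<open>M\<close> stable under
      \<open>T\<close> too, hence everything.\<close>
    define M where "M = \<Inter>{W. ?stable W}"
    have M: "?stable M"
      by (auto simp: M_def complex_subspace_def)
    have least: "M \<subseteq> W" if "?stable W" for W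
      using that by (auto simp: M_def)
    have "?stable {x \<in> M. \<forall>B\<in>T. B *v x \<in> M}"
    proof (intro conjI ballI subsetI)
      show "complex_subspace {x \<in> M. \<forall>B\<in>T. B *v x \<in> M}"
        using M by (simp add: complex_subspace_def matrix_vector_right_distrib matrix_vector_smult)
    next
      fix A w assume A: "A \<in> S" and w: "w \<in> {x \<in> M. \<forall>B\<in>T. B *v x \<in> M}"
      have "B *v (A *v w) \<in> M" if "B \<in> T" for B
        unfolding commute_vec[OF ST[OF A that], of w, symmetric] using A w M that by auto
      then show "A *v w \<in> {x \<in> M. \<forall>B\<in>T. B *v x \<in> M}"
        using M A w by auto
    next
      fix x assume x: "x \<in> ?E"
      have "B *v x \<in> ?E" if "B \<in> T" for B
        using commute_vec[OF YT[OF that], of x] x by (simp add: matrix_vector_smult)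
      then show "x \<in> {x \<in> M. \<forall>B\<in>T. B *v x \<in> M}"
        using M x by auto
    qed
    from least[OF this] have "M = {0} \<or> M = UNIV"
      using irr M unfolding irreducible_rep_def by blast
    then have "M = UNIV"
      using v M by auto
    moreover have "?stable {x. ?q a *v x = 0}"
    proof (intro conjI complex_subspace_kernel ballI subsetI)
      fix A w assume A: "A \<in> S" and w: "w \<in> {x. ?q a *v x = 0}"
      have "Z ** Z ** A = A ** (Z ** Z)" "mat (2 * a - \<i>) ** Z ** A = A ** (mat (2 * a - \<i>) ** Z)"
        "mat (a * a - \<i> * a) ** A = A ** mat (a * a - \<i> * a)"
        using ZS[OF A] by (simp_all add: mat_commute flip: matrix_mul_assoc)
          (simp_all add: mat_commute matrix_mul_assoc ZS[OF A])
      then have "?q a ** A = A ** ?q a"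
        by (simp add: matrix_add_ldistrib matrix_add_rdistrib)
      from commute_vec[OF this, of w] show "A *v w \<in> {x. ?q a *v x = 0}"
        using w by simp
    next
      fix x assume "x \<in> ?E"
      then have x: "Y *v x = a *s x"
        by simp
      have "(mat \<i> ** (Y + Z)) *v x = ((Y + Z) ** (Y + Z)) *v x"
        by (simp add: quad)
      then have "\<i> *s (a *s x + Z *v x) = a *s (a *s x) + a *s (Z *v x) + (a *s (Z *v x) + Z *v (Z *v x))"
        using commute_vec[OF YZ, of x]
        by (simp add: x matrix_vector_mult_add_rdistrib matrix_vector_right_distrib mat_mult_vec
            matrix_vector_smult mult.commute flip: matrix_vector_mul_assoc)
      then show "x \<in> {x. ?q a *v x = 0}"
        by (simp add: vec_eq_iff matrix_vector_mult_add_rdistrib mat_mult_vec algebra_simps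
            flip: matrix_vector_mul_assoc)
    qed
    ultimately have "?q a *v x = 0" for x
      using least by blast
    then show ?thesis
      by (intro cmat_eqI) simp
  qed
  obtain a b v w where ab: "a \<noteq> b" "v \<noteq> 0" "w \<noteq> 0" "Y *v v = a *s v" "Y *v w = b *s w"
    using skew_nonscalar_two_eigenvalues[OF Y] False by blast
  \<comment> \<open>The difference of the two relations is (a - b)(a + b - \<i> + 2 Z) = 0, which
    determines \<open>Z\<close> as a scalar.\<close>
  have "?q a $ i $ j = ?q b $ i $ j" for i j
    using q0 ab by metis
  then have eq: "mat (a * a - \<i> * a) $ i $ j + (2 * a - \<i>) * Z $ i $ j
      = mat (b * b - \<i> * b) $ i $ j + (2 * b - \<i>) * Z $ i $ j" for i j
    by (simp only: vector_add_component mat_mult_nth add_right_cancel)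
  have "Z = mat ((\<i> - a - b) / 2)"
  proof -
    have "Z $ i $ j = (if i = j then (\<i> - a - b) / 2 else 0)" for i j
    proof -
      have "(a - b) * (2 * Z $ i $ j) = (a - b) * ((if i = j then 1 else 0) * (\<i> - a - b))"
        using eq[of i j] by (simp add: mat_def algebra_simps split: if_splits)
      then show ?thesis
        using ab by (auto simp: mult.commute split: if_splits)
    qed
    then show ?thesis
      by (simp add: vec_eq_iff mat_def)
  qed
  then show ?thesis
    by blast
qed simp

section \<open>Unitary matrices with two eigenvalues\<close>

lemma unitary_eigenvalue_norm:
  assumes "unitary_mat g" "c \<in> eigenvalues_mat g"
  shows "cmod c = 1"
proof -
  obtain v where v: "v \<noteq> 0" "g *v v = c *s v"
    using assms by (auto simp: eigenvalues_mat_def)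
  have "(g *v v) \<bullet> (g *v v) = v \<bullet> v"
    using assms by (simp add: inner_mult_vec matrix_vector_mul_assoc unitary_mat_def)
  moreover have "norm (c *s v) = cmod c * norm v"
    by (simp add: norm_vec_def L2_set_right_distrib norm_mult)
  ultimately show ?thesis
    using v by (metis mult_cancel_right1 norm_eq norm_eq_zero)
qed

text \<open>Twice \<open>g\<close> is the sum of a Hermitian and a skew matrix, which commute
  because \<open>g\<close> is normal. A common eigenvector is found by working with the skew part
  inside an eigenspace of the Hermitian part.\<close>

lemma unitary_eigenvector:
  fixes g :: "'n::finite cmat"
  assumes "unitary_mat g" and W: "complex_subspace W" "W \<noteq> {0}" "\<And>w. w \<in> W \<Longrightarrow> g *v w \<in> W"
    "\<And>w. w \<in> W \<Longrightarrow> adj_mat g *v w \<in> W"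
  shows "\<exists>c v. v \<in> W \<and> v \<noteq> 0 \<and> g *v v = c *s v"
proof -
  let ?H = "g + adj_mat g" and ?K = "g - adj_mat g"
  have "\<exists>t v. v \<in> W \<and> v \<noteq> 0 \<and> ?H *v v = complex_of_real t *s v"
    using W by (intro hermitian_eigenvector)
      (auto simp: adj_add matrix_vector_mult_add_rdistrib complex_subspace_def)
  then obtain t v where v: "v \<in> W" "v \<noteq> 0" "?H *v v = complex_of_real t *s v"
    by blast
  let ?U = "W \<inter> {x. ?H *v x = complex_of_real t *s x}"
  have comm: "?H ** ?K = ?K ** ?H"
    using assms(1) by (simp add: unitary_mat_def matrix_ring_simps)
  have "\<exists>s u. u \<in> ?U \<and> u \<noteq> 0 \<and> ?K *v u = s *s u"
  proof (rule skew_eigenvector)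
    show "complex_subspace ?U"
      by (intro complex_subspace_Int W complex_subspace_eigenspace)
    fix w assume w: "w \<in> ?U"
    then have "?K *v w \<in> W"
      using W complex_subspace_imp_subspace[OF W(1)]
      by (auto simp: matrix_vector_mult_diff_rdistrib intro: subspace_diff)
    then show "?K *v w \<in> ?U"
      using commute_vec[OF comm, of w] w by (simp add: matrix_vector_smult)
  qed (use v in \<open>auto simp: adj_diff\<close>)
  then obtain s u where u: "u \<in> ?U" "u \<noteq> 0" "?K *v u = s *s u"
    by blast
  have "2 *s (g *v u) = ?H *v u + ?K *v u"
    by (simp add: matrix_vector_mult_add_rdistrib matrix_vector_mult_diff_rdistrib vec_eq_iff)
  also have "\<dots> = (complex_of_real t + s) *s u"
    using u by (simp add: vector_sadd_rdistrib)
  finally have "g *v u = ((complex_of_real t + s) / 2) *s u"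
    by (simp add: vec_eq_iff field_simps)
  then show ?thesis
    using u by blast
qed

text \<open>Diagonalisability in polynomial form. If the kernel of the product were proper, its
  orthogonal complement would contain an eigenvector of \<open>g\<close>; its eigenvalue is l or m,
  so it would lie in the kernel as well.\<close>

lemma unitary_two_eigenvalues:
  fixes g :: "'n::finite cmat"
  assumes g: "unitary_mat g" and ev: "eigenvalues_mat g = {l, m}" and "l \<noteq> m"
  shows "(g - mat l) ** (g - mat m) = 0"
proof -
  let ?A = "(g - mat l) ** (g - mat m)"
  let ?K = "{v. ?A *v v = 0}"
  let ?W = "{v. \<forall>w\<in>?K. v \<bullet> w = 0}"
  have gA: "g ** ?A = ?A ** g" "adj_mat g ** ?A = ?A ** adj_mat g"
  proof -
    have "adj_mat g ** g = g ** adj_mat g"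
      using g by (simp add: unitary_mat_def)
    then have *: "adj_mat g ** (g - mat c) = (g - mat c) ** adj_mat g"
      "g ** (g - mat c) = (g - mat c) ** g" for c
      by (simp_all add: matrix_diff_ldistrib matrix_diff_rdistrib mat_commute)
    show "g ** ?A = ?A ** g"
      by (simp only: matrix_mul_assoc *) (simp only: * flip: matrix_mul_assoc)
    show "adj_mat g ** ?A = ?A ** adj_mat g"
      by (simp only: matrix_mul_assoc *) (simp only: * flip: matrix_mul_assoc)
  qed
  have K: "complex_subspace ?K"
    by (rule complex_subspace_kernel)
  have stab: "B *v w \<in> ?W" if "adj_mat B ** ?A = ?A ** adj_mat B" "w \<in> ?W" for B w
  proof -
    have "adj_mat B *v x \<in> ?K" if "x \<in> ?K" for x
      using commute_vec[OF \<open>adj_mat B ** ?A = ?A ** adj_mat B\<close>, of x] that by simp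
    then show ?thesis
      using that by (simp add: inner_mult_vec)
  qed
  have "?K = UNIV"
  proof (rule ccontr)
    assume "?K \<noteq> UNIV"
    then have "?W \<noteq> {0}"
      by (intro orthogonal_complement_nontrivial complex_subspace_imp_subspace K)
    then obtain c v where v: "v \<in> ?W" "v \<noteq> 0" "g *v v = c *s v"
      using unitary_eigenvector[OF g complex_subspace_orthogonal[OF K]] stab gA
      by (metis (no_types, lifting) adj_adj)
    then have "c \<in> {l, m}"
      using ev by (auto simp: eigenvalues_mat_def)
    moreover have "?A *v v = (c - l) *s ((c - m) *s v)"
      by (simp add: matrix_vector_mult_diff_rdistrib mat_mult_vec v matrix_vector_mult_diff_distrib
          matrix_vector_smult flip: matrix_vector_mul_assoc) (simp add: vec_eq_iff algebra_simps)
    ultimately have "v \<in> ?K"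
      by auto
    then show False
      using v by auto
  qed
  then show ?thesis
    by (intro cmat_eqI) auto
qed

subsection \<open>Lie algebras of closed unitary groups\<close>

lemma unitary_matpow: "unitary_mat A \<Longrightarrow> unitary_mat (matpow A k)"
  by (induction k) (auto intro: unitary_1 unitary_mult)

lemma subgroup_matpow: "is_subgroup H \<Longrightarrow> a \<in> H \<Longrightarrow> matpow a k \<in> H"
  by (induction k) (auto simp: is_subgroup_def)

text \<open>Telescoping: unitary factors preserve the norm, so the error of a power grows only
  linearly in the exponent.\<close>

lemma norm_matpow_diff:
  fixes a b :: "'n::finite cmat"
  assumes "unitary_mat a" "unitary_mat b"
  shows "norm (matpow a k - matpow b k) \<le> real k * norm (a - b)"
proof (induction k)
  case (Suc k)
  have "matpow a (Suc k) - matpow b (Suc k) = a ** (matpow a k - matpow b k) + (a - b) ** matpow b k"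
    by (simp add: matrix_ring_simps)
  also have "norm \<dots> \<le> norm (matpow a k - matpow b k) + norm (a - b)"
    using norm_triangle_ineq[of "a ** (matpow a k - matpow b k)" "(a - b) ** matpow b k"]
    by (simp add: norm_unitary_mult norm_mult_unitary unitary_matpow assms)
  finally show ?case
    using Suc by (simp add: algebra_simps)
qed simp

text \<open>Passing from A to exp A - 1 costs a quadratic remainder, which disappears in the limit.
  The scale e is kept independent of A because it is taken both as 1/(n + 1) and as the norm of
  A.\<close>

lemma mexp_quotient:
  fixes A :: "'b \<Rightarrow> 'n::finite cmat"
  assumes A: "(A \<longlongrightarrow> 0) F" and U: "((\<lambda>n. (1 / e n) *\<^sub>R A n) \<longlongrightarrow> U) F"
  shows "((\<lambda>n. (1 / e n) *\<^sub>R (mexp (A n) - mat 1)) \<longlongrightarrow> U) F"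
proof -
  let ?c = "norm (mat 1 :: 'n cmat)"
  let ?R = "\<lambda>n. (1 / e n) *\<^sub>R (mexp (A n) - mat 1 - A n)"
  have "((\<lambda>n. norm ((1 / e n) *\<^sub>R A n) * (?c * norm (A n) * exp (norm (A n)))) \<longlongrightarrow> norm U * (?c * norm (0 :: 'n cmat) * exp (norm (0 :: 'n cmat)))) F"
    by (intro tendsto_intros A U)
  then have lim: "((\<lambda>n. norm ((1 / e n) *\<^sub>R A n) * (?c * norm (A n) * exp (norm (A n)))) \<longlongrightarrow> 0) F"
    by simp
  have "norm (?R n) \<le> norm ((1 / e n) *\<^sub>R A n) * (?c * norm (A n) * exp (norm (A n)))" for n
    using mult_left_mono[OF mexp_bound[of "A n"], of "\<bar>1 / e n\<bar>"]
    by (simp add: power2_eq_square mult_ac)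
  then have "(?R \<longlongrightarrow> 0) F"
    by (intro Lim_null_comparison[OF _ lim]) simp
  from tendsto_add[OF this U] show ?thesis
    by (simp add: algebra_simps)
qed

lemma tendsto_mexp [tendsto_intros]:
  "(f \<longlongrightarrow> A) F \<Longrightarrow> ((\<lambda>x. mexp (f x)) \<longlongrightarrow> mexp (A :: 'n::finite cmat)) F"
  using continuous_on_tendsto_compose[OF continuous_on_mexp[of UNIV]] by simp

text \<open>Put g = 1 + e D in g g* = 1, divide by e and let e tend to 0.\<close>

lemma skew_limit:
  fixes g :: "nat \<Rightarrow> 'n::finite cmat"
  assumes g: "\<And>n. unitary_mat (g n)" and e: "\<And>n. e n \<noteq> 0" "e \<longlonglongrightarrow> 0"
    and U: "(\<lambda>n. (1 / e n) *\<^sub>R (g n - mat 1)) \<longlonglongrightarrow> U"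
  shows "adj_mat U = - U"
proof -
  define D where "D n = (1 / e n) *\<^sub>R (g n - mat 1)" for n
  have "D n + adj_mat (D n) + e n *\<^sub>R (D n ** adj_mat (D n)) = 0" for n
  proof -
    have "(g n - mat 1) + (adj_mat (g n) - mat 1) + (g n - mat 1) ** (adj_mat (g n) - mat 1) = 0"
      using g[of n] by (simp add: unitary_mat_def matrix_ring_simps)
    then have "(1 / e n) *\<^sub>R (g n - mat 1) + (1 / e n) *\<^sub>R (adj_mat (g n) - mat 1)
        + (1 / e n) *\<^sub>R ((g n - mat 1) ** (adj_mat (g n) - mat 1)) = 0"
      by (metis scaleR_add_right scaleR_zero_right)
    then show ?thesis
      using e(1)[of n]
      by (simp add: D_def adj_scaleR adj_diff matrix_scaleR_left matrix_scaleR_right)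
  qed
  moreover have D: "D \<longlonglongrightarrow> U"
    using U by (simp add: D_def[abs_def])
  then have "(\<lambda>n. D n + adj_mat (D n) + e n *\<^sub>R (D n ** adj_mat (D n))) \<longlonglongrightarrow> U + adj_mat U + 0 *\<^sub>R (U ** adj_mat U)"
    by (intro tendsto_intros e)
  ultimately have "U + adj_mat U = 0"
    by (simp add: LIMSEQ_const_iff)
  then show ?thesis
    by (simp add: add_eq_0_iff)
qed

lemma mexp_in_subgroup_minus: "is_subgroup K \<Longrightarrow> mexp A \<in> K \<Longrightarrow> mexp (- A) \<in> K"
  by (metis is_subgroup_def matrix_inv_mexp)

text \<open>The core of the closed subgroup theorem. Powers of \<open>g n\<close> with exponent
  about t / e stay in \<open>K\<close> and follow exp (t U): their error is at most the exponent
  times the error of one factor, that is, t times the distance of two difference quotients with the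
  same limit.\<close>

lemma lie_algebra_limitI:
  fixes g :: "nat \<Rightarrow> 'n::finite cmat"
  assumes K: "compact_unitary_group K" and g: "\<And>n. g n \<in> K"
    and e: "\<And>n. e n > 0" "e \<longlonglongrightarrow> 0"
    and U: "(\<lambda>n. (1 / e n) *\<^sub>R (g n - mat 1)) \<longlonglongrightarrow> U"
  shows "U \<in> lie_algebra K"
proof -
  have sub: "is_subgroup K" and un: "\<And>h. h \<in> K \<Longrightarrow> unitary_mat h" and cl: "closed K"
    using K by (auto simp: compact_unitary_group_def)
  have skew: "adj_mat U = - U"
  proof (rule skew_limit[OF _ _ e(2) U])
    show "e n \<noteq> 0" for n
      using e(1)[of n] by simp
  qed (use g un in auto)
  have pos: "mexp (t *\<^sub>R U) \<in> K" if t: "t > 0" for t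
  proof -
    \<comment> \<open>Rounding down leaves k e within e of t, so k e tends to t.\<close>
    define k where "k n = nat \<lfloor>t / e n\<rfloor>" for n
    have k: "real (k n) \<le> t / e n" "t / e n - 1 \<le> real (k n)" for n
      using t e(1)[of n] by (auto simp: k_def)
    have "(\<lambda>n. real (k n) * e n) \<longlonglongrightarrow> t"
    proof (rule tendsto_sandwich)
      show "\<forall>\<^sub>F n in sequentially. t - e n \<le> real (k n) * e n"
        using k(2) e(1) by (simp add: field_simps)
      show "\<forall>\<^sub>F n in sequentially. real (k n) * e n \<le> t"
        using k(1) e(1) by (simp add: field_simps)
      show "(\<lambda>n. t - e n) \<longlonglongrightarrow> t"
        using tendsto_diff[OF tendsto_const e(2), of t] by simp
    qed simp
    then have 1: "(\<lambda>n. mexp ((real (k n) * e n) *\<^sub>R U)) \<longlonglongrightarrow> mexp (t *\<^sub>R U)"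
      by (intro tendsto_intros)
    let ?d = "\<lambda>n. (1 / e n) *\<^sub>R (g n - mat 1) - (1 / e n) *\<^sub>R (mexp (e n *\<^sub>R U) - mat 1)"
    have "(\<lambda>n. (1 / e n) *\<^sub>R (mexp (e n *\<^sub>R U) - mat 1)) \<longlonglongrightarrow> U"
    proof (rule mexp_quotient)
      show "(\<lambda>n. e n *\<^sub>R U) \<longlonglongrightarrow> 0"
        using tendsto_scaleR[OF e(2) tendsto_const, of U] by simp
      have "(1 / e n) *\<^sub>R e n *\<^sub>R U = U" for n
        using e(1)[of n] by simp
      then show "(\<lambda>n. (1 / e n) *\<^sub>R e n *\<^sub>R U) \<longlonglongrightarrow> U"
        by simp
    qed
    then have "(\<lambda>n. t * norm (?d n)) \<longlonglongrightarrow> t * norm (U - U)"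
      by (intro tendsto_intros U)
    then have lim: "(\<lambda>n. t * norm (?d n)) \<longlonglongrightarrow> 0"
      by simp
    have "norm (matpow (g n) (k n) - mexp ((real (k n) * e n) *\<^sub>R U)) \<le> t * norm (?d n)" for n
    proof -
      have "norm (matpow (g n) (k n) - matpow (mexp (e n *\<^sub>R U)) (k n)) \<le> real (k n) * norm (g n - mexp (e n *\<^sub>R U))"
        by (rule norm_matpow_diff) (auto intro!: un g unitary_mexp simp: adj_scaleR skew)
      also have "\<dots> \<le> t / e n * norm (g n - mexp (e n *\<^sub>R U))"
        by (intro mult_right_mono k) simp
      also have "\<dots> = t * norm (?d n)"
        using e(1)[of n] by (simp flip: scaleR_diff_right)
      finally show ?thesis
        by (simp add: mexp_mult_nat)
    qed
    then have "(\<lambda>n. matpow (g n) (k n) - mexp ((real (k n) * e n) *\<^sub>R U)) \<longlonglongrightarrow> 0"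
      by (intro Lim_null_comparison[OF _ lim]) simp
    from tendsto_add[OF this 1] have "(\<lambda>n. matpow (g n) (k n)) \<longlonglongrightarrow> mexp (t *\<^sub>R U)"
      by simp
    then show ?thesis
      by (rule closed_sequentially[OF cl subgroup_matpow[OF sub g]])
  qed
  have "mexp (t *\<^sub>R U) \<in> K" for t
  proof (cases t "0 :: real" rule: linorder_cases)
    case less
    then show ?thesis
      using mexp_in_subgroup_minus[OF sub pos[of "- t"]] by simp
  qed (use sub pos in \<open>auto simp: is_subgroup_def\<close>)
  then show ?thesis
    by (simp add: lie_algebra_def)
qed

lemma inverse_Suc_null: "(\<lambda>n. 1 / real (Suc n)) \<longlonglongrightarrow> 0"
  using LIMSEQ_inverse_real_of_nat by (simp add: inverse_eq_divide)

text \<open>The double reciprocal is left unsimplified so that it matches the scale e = 1/(n + 1) in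
  \<open>skew_limit\<close> and \<open>lie_algebra_limitI\<close>.\<close>

lemma mexp_quotient_Suc:
  "(\<lambda>n. (1 / (1 / real (Suc n))) *\<^sub>R (mexp ((1 / real (Suc n)) *\<^sub>R X) - mat 1)) \<longlonglongrightarrow> (X :: 'n::finite cmat)"
proof (rule mexp_quotient)
  show "(\<lambda>n. (1 / real (Suc n)) *\<^sub>R X) \<longlonglongrightarrow> 0"
    using tendsto_scaleR[OF inverse_Suc_null tendsto_const, of X] by simp
qed (simp del: of_nat_Suc)

lemma mexp_Suc_tendsto_1: "(\<lambda>n. mexp ((1 / real (Suc n)) *\<^sub>R X)) \<longlonglongrightarrow> (mat 1 :: 'n::finite cmat)"
proof -
  have "(\<lambda>n. (1 / real (Suc n)) *\<^sub>R X) \<longlonglongrightarrow> 0"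
    using tendsto_scaleR[OF inverse_Suc_null tendsto_const, of X] by simp
  then show ?thesis
    using tendsto_mexp by fastforce
qed

lemma lie_algebra_skew:
  assumes "X \<in> lie_algebra K" "\<And>h. h \<in> K \<Longrightarrow> unitary_mat h"
  shows "adj_mat X = - X"
  by (rule skew_limit[OF _ _ inverse_Suc_null mexp_quotient_Suc[of X]])
    (use assms in \<open>auto simp: lie_algebra_def\<close>)

text \<open>Only additivity needs closedness of \<open>K\<close>: X + Y is the limit direction of
  the products exp (e X) exp (e Y), by the product rule for difference quotients.\<close>

lemma subspace_lie_algebra:
  assumes K: "compact_unitary_group K"
  shows "subspace (lie_algebra K)"
  unfolding subspace_def
proof (intro conjI ballI allI)
  show "0 \<in> lie_algebra K"
    using K by (simp add: lie_algebra_def compact_unitary_group_def is_subgroup_def)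
next
  fix c X assume "X \<in> lie_algebra K"
  then show "c *\<^sub>R X \<in> lie_algebra K"
    by (simp add: lie_algebra_def)
next
  fix X Y assume XY: "X \<in> lie_algebra K" "Y \<in> lie_algebra K"
  let ?e = "\<lambda>n. 1 / real (Suc n)"
  let ?g = "\<lambda>n. mexp (?e n *\<^sub>R X) ** mexp (?e n *\<^sub>R Y)"
  show "X + Y \<in> lie_algebra K"
  proof (rule lie_algebra_limitI[OF K, of ?g ?e])
    show "?g n \<in> K" for n
      using K XY by (simp add: lie_algebra_def compact_unitary_group_def is_subgroup_def)
    have "(\<lambda>n. (1 / ?e n) *\<^sub>R (mexp (?e n *\<^sub>R X) - mat 1) ** mexp (?e n *\<^sub>R Y) + (1 / ?e n) *\<^sub>R (mexp (?e n *\<^sub>R Y) - mat 1))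
        \<longlonglongrightarrow> X ** mat 1 + Y"
      by (intro tendsto_intros mexp_quotient_Suc mexp_Suc_tendsto_1)
    then show "(\<lambda>n. (1 / ?e n) *\<^sub>R (?g n - mat 1)) \<longlonglongrightarrow> X + Y"
      by (simp add: matrix_ring_simps scaleR_diff_right del: of_nat_Suc)
  qed (use inverse_Suc_null in auto)
qed

text \<open>The bracket is the derivative at 0 of conjugation by exp (t X), and a subspace of a
  finite-dimensional space is closed.\<close>

lemma bracket_in_subspace:
  fixes X Y :: "'n::finite cmat"
  assumes S: "subspace S" "Y \<in> S" and Ad: "\<And>t. mexp (t *\<^sub>R X) ** Y ** mexp (- (t *\<^sub>R X)) \<in> S"
  shows "X ** Y - Y ** X \<in> S"
proof -
  let ?e = "\<lambda>n. 1 / real (Suc n)"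
  let ?E = "\<lambda>n. mexp (?e n *\<^sub>R X)" and ?E' = "\<lambda>n. mexp (?e n *\<^sub>R (- X))"
  have "(\<lambda>n. (1 / ?e n) *\<^sub>R (?E n - mat 1) ** Y ** ?E' n + Y ** ((1 / ?e n) *\<^sub>R (?E' n - mat 1)))
      \<longlonglongrightarrow> X ** Y ** mat 1 + Y ** (- X)"
    by (intro tendsto_intros mexp_quotient_Suc mexp_Suc_tendsto_1)
  moreover have "(1 / ?e n) *\<^sub>R (?E n - mat 1) ** Y ** ?E' n + Y ** ((1 / ?e n) *\<^sub>R (?E' n - mat 1))
      = (1 / ?e n) *\<^sub>R (?E n ** Y ** ?E' n - Y)" for n
    by (simp add: matrix_ring_simps scaleR_diff_right del: of_nat_Suc)
  ultimately have "(\<lambda>n. (1 / ?e n) *\<^sub>R (?E n ** Y ** ?E' n - Y)) \<longlonglongrightarrow> X ** Y - Y ** X"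
    by (simp add: matrix_minus_right)
  moreover have "(1 / ?e n) *\<^sub>R (?E n ** Y ** ?E' n - Y) \<in> S" for n
    using Ad[of "?e n"] S by (intro subspace_scale subspace_diff) auto
  ultimately show ?thesis
    by (metis (no_types, lifting) closed_sequentially closed_subspace S(1))
qed

lemma lie_algebra_Ad:
  assumes k: "unitary_mat k" "\<And>h. h \<in> K \<Longrightarrow> k ** h ** adj_mat k \<in> K" and X: "X \<in> lie_algebra K"
  shows "k ** X ** adj_mat k \<in> lie_algebra K"
proof -
  have "mexp (t *\<^sub>R (k ** X ** adj_mat k)) = k ** mexp (t *\<^sub>R X) ** adj_mat k" for t
    using mexp_conj[of "adj_mat k" k "t *\<^sub>R X"] k(1)
    by (simp add: unitary_mat_def matrix_scaleR_left matrix_scaleR_right)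
  then show ?thesis
    using k X by (simp add: lie_algebra_def)
qed

text \<open>Nonzero counterexamples tending to 0 would, after normalisation, accumulate at a unit
  vector of \<open>N\<close>. With their norms as scale, \<open>lie_algebra_limitI\<close> puts this
  vector into the Lie algebra.\<close>

lemma small_exp_in_complement:
  fixes K N :: "'n::finite cmat set"
  assumes K: "compact_unitary_group K" and N: "subspace N" "N \<inter> lie_algebra K = {0}"
  shows "\<exists>\<epsilon>>0. \<forall>A\<in>N. norm A < \<epsilon> \<and> mexp A \<in> K \<longrightarrow> A = 0"
proof (rule ccontr)
  assume "\<not> ?thesis"
  then have "\<forall>n. \<exists>A\<in>N. norm A < 1 / real (Suc n) \<and> mexp A \<in> K \<and> A \<noteq> 0"
    by (metis of_nat_0_less_iff zero_less_Suc zero_less_divide_1_iff)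
  then obtain A where A: "\<And>n. A n \<in> N" "\<And>n. norm (A n) < 1 / real (Suc n)" "\<And>n. mexp (A n) \<in> K" "\<And>n. A n \<noteq> 0"
    by metis
  let ?S = "N \<inter> sphere 0 1"
  have "compact ?S"
    using closed_subspace[OF N(1)] by (simp add: closed_Int_compact)
  moreover have "(1 / norm (A n)) *\<^sub>R A n \<in> ?S" for n
    using A(1,4)[of n] N(1) by (simp add: subspace_scale)
  ultimately obtain U r where U: "U \<in> ?S" and r: "strict_mono r"
    and lim: "((\<lambda>n. (1 / norm (A n)) *\<^sub>R A n) \<circ> r) \<longlonglongrightarrow> U"
    unfolding compact_def by (metis (no_types, lifting))
  have A0: "A \<longlonglongrightarrow> 0"
    by (rule Lim_null_comparison[OF _ inverse_Suc_null]) (use A(2) in \<open>simp add: less_imp_le del: of_nat_Suc\<close>)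
  then have Ar: "(\<lambda>n. A (r n)) \<longlonglongrightarrow> 0"
    using LIMSEQ_subseq_LIMSEQ[OF A0 r] by (simp add: o_def)
  have "U \<in> lie_algebra K"
  proof (rule lie_algebra_limitI[OF K, of "\<lambda>n. mexp (A (r n))" "\<lambda>n. norm (A (r n))"])
    show "(\<lambda>n. norm (A (r n))) \<longlonglongrightarrow> 0"
      using tendsto_norm_zero[OF Ar] .
    show "(\<lambda>n. (1 / norm (A (r n))) *\<^sub>R (mexp (A (r n)) - mat 1)) \<longlonglongrightarrow> U"
      using lim by (intro mexp_quotient[OF Ar]) (simp add: o_def)
  qed (use A in auto)
  then have "U \<in> N \<inter> lie_algebra K"
    using U by blast
  then show False
    using U N(2) by auto
qed

text \<open>Coordinates of the second kind: the product of the one-parameter groups of a basis, completed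
  by the exponential of a complement, is open at the origin; near the identity an element of \<open>K\<close>
  has no component in the complement.\<close>

lemma lie_algebra_subset_of_generators:
  fixes H K B :: "'n::finite cmat set"
  assumes K: "compact_unitary_group K" and H: "is_subgroup H" "H \<subseteq> K"
    and B: "B \<subseteq> lie_algebra H" "lie_algebra K \<subseteq> span B"
  shows "lie_algebra K \<subseteq> lie_algebra H"
proof
  fix X assume X: "X \<in> lie_algebra K"
  obtain C where C: "C \<subseteq> B" "independent C" "B \<subseteq> span C"
    using maximal_independent_subset by blast
  have finC: "finite C"
    using C(2) by (rule independent_imp_finite)
  have "\<exists>f. linear f \<and> (\<forall>c\<in>C. f c = (if c = b then 1 else 0 :: real))" for b
    by (rule linear_independent_extend[OF C(2)])
  then obtain r where lin: "\<And>b. linear (r b)" and rC: "\<And>b c. c \<in> C \<Longrightarrow> r b c = (if c = b then 1 else 0 :: real)"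
    by metis
  define s where "s A = (\<Sum>b\<in>C. r b A *\<^sub>R b)" for A
  define q where "q A = A - s A" for A
  have lin_s: "linear s"
    unfolding s_def
    by (intro linear_compose_sum ballI linearI)
      (simp_all add: linear_add[OF lin] linear_cmul[OF lin] scaleR_add_left)
  have lin_q: "linear q"
    unfolding q_def by (intro linear_compose_sub lin_s) (simp add: linear_ident)
  have sC: "s c = c" if "c \<in> C" for c
    using that finC by (simp add: s_def rC if_distrib[of "\<lambda>x. x *\<^sub>R _"] cong: if_cong)
  have s_span: "s A = A" if "A \<in> span C" for A
    using linear_eq_on_span[OF lin_s linear_ident, of C A] sC that by simp
  have r_s: "r b (s A) = r b A" if "b \<in> C" for b A
    using that finC
    by (simp add: s_def linear_sum[OF lin] linear_cmul[OF lin] rC if_distrib[of "\<lambda>x. _ * x"] cong: if_cong)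
  define N where "N = {A. \<forall>b\<in>C. r b A = 0}"
  have N: "subspace N"
    by (simp add: N_def subspace_def linear_0[OF lin] linear_add[OF lin] linear_cmul[OF lin])
  have qN: "q A \<in> N" for A
    by (simp add: N_def q_def linear_diff[OF lin] r_s)
  have LC: "lie_algebra K \<subseteq> span C"
    using B(2) span_minimal[OF C(3) subspace_span] by (rule subset_trans)
  have "A = 0" if "A \<in> N" "A \<in> lie_algebra K" for A
  proof -
    have "A = s A"
      using s_span[of A] LC that(2) by auto
    also have "\<dots> = 0"
      using that(1) by (simp add: N_def s_def)
    finally show ?thesis .
  qed
  then have NK: "N \<inter> lie_algebra K = {0}"
    using subspace_0[OF N] subspace_0[OF subspace_lie_algebra[OF K]] by auto
  obtain \<epsilon> where \<epsilon>: "\<epsilon> > 0" "\<And>A. A \<in> N \<Longrightarrow> norm A < \<epsilon> \<Longrightarrow> mexp A \<in> K \<Longrightarrow> A = 0"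
    using small_exp_in_complement[OF K N NK] by auto
  define F where "F bs A = foldr (\<lambda>b M. mexp (r b A *\<^sub>R b) ** M) bs (mexp (q A))" for bs A
  have blin: "bounded_linear (r b)" "bounded_linear q" for b
    using lin lin_q by (simp_all add: linear_conv_bounded_linear)
  have F0: "F bs 0 = mat 1" for bs
    by (induction bs) (simp_all add: F_def linear_0[OF lin] linear_0[OF lin_q])
  have contF: "continuous_on UNIV (F bs)" for bs
    unfolding F_def
    by (induction bs) (auto intro!: continuous_intros bounded_linear.continuous_on[OF blin(1)] bounded_linear.continuous_on[OF blin(2)])
  have derF: "(F bs has_derivative (\<lambda>A. (\<Sum>b\<leftarrow>bs. r b A *\<^sub>R b) + q A)) (at 0)" for bs
  proof (induction bs)
    case Nil
    have "((\<lambda>A. mexp (q A)) has_derivative q) (at 0)"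
      by (rule has_derivative_compose[OF bounded_linear.has_derivative[OF blin(2) has_derivative_ident]])
        (simp add: linear_0[OF lin_q] has_derivative_mexp_0)
    then show ?case
      by (simp add: F_def[abs_def])
  next
    case (Cons b bs)
    have "((\<lambda>A. r b A *\<^sub>R b) has_derivative (\<lambda>A. r b A *\<^sub>R b)) (at 0)"
      by (intro has_derivative_scaleR_left bounded_linear.has_derivative[OF blin(1) has_derivative_ident])
    then have "((\<lambda>A. mexp (r b A *\<^sub>R b)) has_derivative (\<lambda>A. r b A *\<^sub>R b)) (at 0)"
      by (rule has_derivative_compose) (simp add: linear_0[OF lin] has_derivative_mexp_0)
    from bounded_bilinear.FDERIV[OF bounded_bilinear_cmat_mult this Cons]
    show ?case
      by (simp add: F_def[of "b # bs", abs_def] F_def[of bs, symmetric, abs_def] F0 linear_0[OF lin] add_ac)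
  qed
  have F_H: "\<exists>h\<in>H. F bs A = h ** mexp (q A)" if "set bs \<subseteq> C" for bs A
    using that
  proof (induction bs)
    case Nil
    then show ?case
      using H(1) by (auto simp: F_def is_subgroup_def intro!: bexI[of _ "mat 1"])
  next
    case (Cons b bs)
    then obtain h where h: "h \<in> H" "F bs A = h ** mexp (q A)"
      by auto
    have "mexp (r b A *\<^sub>R b) \<in> H"
      using Cons.prems C(1) B(1) by (auto simp: lie_algebra_def)
    then have "mexp (r b A *\<^sub>R b) ** h \<in> H"
      using H(1) h by (simp add: is_subgroup_def)
    then show ?case
      using h by (auto simp: F_def matrix_mul_assoc intro!: bexI[of _ "mexp (r b A *\<^sub>R b) ** h"])
  qed
  obtain bs where bs: "set bs = C" "distinct bs"
    using finite_distinct_list[OF finC] by blast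
  \<comment> \<open>The derivative at the origin is s + q, the identity by definition of q.\<close>
  have derF': "(F bs has_derivative id) (at 0)"
    using derF[of bs] by (simp add: sum_list_distinct_conv_sum_set[OF bs(2)] bs(1) q_def s_def id_def)
  have "isCont q 0"
    by (rule linear_continuous_at[OF blin(2)])
  then obtain \<delta> where \<delta>: "\<delta> > 0" "\<And>A. norm A < \<delta> \<Longrightarrow> norm (q A) < \<epsilon>"
    using \<epsilon>(1) unfolding continuous_at_eps_delta by (auto simp: linear_0[OF lin_q])
  \<comment> \<open>This open mapping theorem takes continuity and the derivative at a single point,
    which is what is known about \<open>mexp\<close>.\<close>
  have "F bs 0 \<in> interior (F bs ` ball 0 \<delta>)"
    by (rule sussmann_open_mapping[OF open_UNIV contF _ derF', of id]) (use \<delta> in \<open>auto simp: id_def\<close>)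
  then obtain d where d: "d > 0" "ball (mat 1) d \<subseteq> F bs ` ball 0 \<delta>"
    by (auto simp: F0 mem_interior)
  have "continuous (at 0) (\<lambda>t. mexp (t *\<^sub>R X))"
    by (rule continuous_on_interior[of UNIV]) (auto intro!: continuous_intros)
  then obtain \<eta> where \<eta>: "\<eta> > 0" "\<And>t. \<bar>t\<bar> < \<eta> \<Longrightarrow> dist (mexp (t *\<^sub>R X)) (mat 1) < d"
    using d(1) unfolding continuous_at_eps_delta by (auto simp: dist_norm)
  have small: "mexp (t *\<^sub>R X) \<in> H" if "\<bar>t\<bar> < \<eta>" for t
  proof -
    have "mexp (t *\<^sub>R X) \<in> F bs ` ball 0 \<delta>"
      using \<eta>(2)[OF that] d(2) by (auto simp: dist_commute)
    then obtain A where A: "norm A < \<delta>" "mexp (t *\<^sub>R X) = F bs A"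
      by auto
    then obtain h where h: "h \<in> H" "mexp (t *\<^sub>R X) = h ** mexp (q A)"
      using F_H[of bs A] bs by auto
    have "matrix_inv h ** h = mat 1" "matrix_inv h \<in> K"
      using h(1) H K unitary_inv[of h] by (auto simp: compact_unitary_group_def is_subgroup_def unitary_mat_def subset_iff)
    then have "mexp (q A) = matrix_inv h ** mexp (t *\<^sub>R X)"
      by (simp add: h(2) matrix_mul_assoc)
    also have "\<dots> \<in> K"
      using \<open>matrix_inv h \<in> K\<close> X K by (simp add: lie_algebra_def compact_unitary_group_def is_subgroup_def)
    finally have "q A = 0"
      using \<epsilon>(2)[OF qN \<delta>(2)[OF A(1)]] by simp
    then show ?thesis
      using h by simp
  qed
  \<comment> \<open>Small parameters suffice, since exp (t X) is a power of exp (t X / n).\<close>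
  have "mexp (t *\<^sub>R X) \<in> H" for t
  proof -
    obtain n where "\<bar>t\<bar> / \<eta> < real n"
      using reals_Archimedean2 by blast
    then have n: "\<bar>t\<bar> / \<eta> < real (Suc n)"
      by simp
    then have "\<bar>t / real (Suc n)\<bar> < \<eta>"
      using \<eta>(1) by (simp add: field_simps)
    from subgroup_matpow[OF H(1) small[OF this], of "Suc n"] show ?thesis
      unfolding mexp_mult_nat by simp
  qed
  then show "X \<in> lie_algebra H"
    by (simp add: lie_algebra_def)
qed

section \<open>Identity components, compactness and closures\<close>

lemma identity_component_subset: "identity_component K \<subseteq> K"
  unfolding identity_component_def by (rule connected_component_subset)

lemma connected_subset_identity_component:
  "connected T \<Longrightarrow> T \<subseteq> K \<Longrightarrow> mat 1 \<in> T \<Longrightarrow> T \<subseteq> identity_component K"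
  unfolding identity_component_def by (rule connected_component_maximal)

text \<open>A translate of the component by the element a is connected; it contains the identity
  because the adjoint of a, which is its inverse, is in the component too.\<close>

lemma is_subgroup_identity_component:
  assumes K: "is_subgroup K" and un: "\<And>h. h \<in> K \<Longrightarrow> unitary_mat h"
  shows "is_subgroup (identity_component K)"
proof -
  let ?C = "identity_component K"
  have conn: "connected ?C"
    by (simp add: identity_component_def)
  have one: "mat 1 \<in> ?C"
    using K by (simp add: identity_component_def is_subgroup_def)
  have adj: "adj_mat a \<in> K" if "a \<in> K" for a
    using K that unitary_inv[OF un[OF that]] by (auto simp: is_subgroup_def)
  have inv: "adj_mat ` ?C \<subseteq> ?C"
  proof (rule connected_subset_identity_component)
    show "connected (adj_mat ` ?C)"
      by (intro connected_continuous_image conn continuous_intros)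
    show "mat 1 \<in> adj_mat ` ?C"
      using one by (metis adj_mat_1 image_eqI)
  qed (use adj identity_component_subset in blast)
  have mult: "a ** b \<in> ?C" if "a \<in> ?C" "b \<in> ?C" for a b
  proof -
    have aK: "a \<in> K" "unitary_mat a"
      using that identity_component_subset un by blast+
    have "(\<lambda>x. a ** x) ` ?C \<subseteq> ?C"
    proof (rule connected_subset_identity_component)
      show "connected ((\<lambda>x. a ** x) ` ?C)"
        by (intro connected_continuous_image conn continuous_intros)
      show "(\<lambda>x. a ** x) ` ?C \<subseteq> K"
        using aK K identity_component_subset[of K] by (auto simp: is_subgroup_def)
      have "a ** adj_mat a = mat 1" "adj_mat a \<in> ?C"
        using aK that(1) inv by (auto simp: unitary_mat_def)
      then show "mat 1 \<in> (\<lambda>x. a ** x) ` ?C"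
        by force
    qed
    then show ?thesis
      using that by blast
  qed
  show ?thesis
    by (rule is_subgroup_unitaryI) (use one mult inv un identity_component_subset in blast)+
qed

lemma mexp_in_identity_component:
  assumes "X \<in> lie_algebra K"
  shows "mexp X \<in> identity_component K"
proof -
  have "range (\<lambda>t. mexp (t *\<^sub>R X)) \<subseteq> identity_component K"
  proof (rule connected_subset_identity_component)
    show "connected (range (\<lambda>t. mexp (t *\<^sub>R X)))"
      by (intro connected_continuous_image continuous_intros connected_UNIV)
    show "mat 1 \<in> range (\<lambda>t. mexp (t *\<^sub>R X))"
      by (rule image_eqI[of _ _ 0]) auto
  qed (use assms in \<open>auto simp: lie_algebra_def\<close>)
  then show ?thesis
    by (metis range_subsetD scaleR_one)
qed

lemma compact_compact_unitary_group:
  fixes K :: "'n::finite cmat set"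
  assumes "compact_unitary_group K"
  shows "compact K"
proof -
  have "norm h = norm (mat 1 :: 'n cmat)" if "h \<in> K" for h
    using norm_mult_unitary[of h "mat 1"] assms that by (simp add: compact_unitary_group_def)
  then have "bounded K"
    by (metis bounded_iff order_refl)
  then show ?thesis
    using assms by (simp add: compact_eq_bounded_closed compact_unitary_group_def)
qed

lemma compact_unitary_group_identity_component:
  assumes "compact_unitary_group K"
  shows "compact_unitary_group (identity_component K)"
  using assms is_subgroup_identity_component[of K] identity_component_subset[of K]
    closed_connected_component[of K "mat 1"]
  by (auto simp: compact_unitary_group_def identity_component_def)

lemma compact_unitary_group_closure:
  assumes G: "compact_unitary_group G" and H: "is_subgroup H" "H \<subseteq> G"
  shows "compact_unitary_group (closure H)"
proof -
  have sub: "closure H \<subseteq> G"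
    using G H(2) by (simp add: closure_minimal compact_unitary_group_def)
  have un: "\<And>a. a \<in> closure H \<Longrightarrow> unitary_mat a"
    using sub G by (auto simp: compact_unitary_group_def)
  have adjH: "adj_mat a \<in> H" if "a \<in> H" for a
    using H(1) that unitary_inv[OF un] closure_subset[of H] by (auto simp: is_subgroup_def subset_iff)
  have "is_subgroup (closure H)"
  proof (rule is_subgroup_unitaryI)
    show "mat 1 \<in> closure H"
      using H(1) closure_subset[of H] by (auto simp: is_subgroup_def)
    show "a ** b \<in> closure H" if ab: "a \<in> closure H" "b \<in> closure H" for a b
    proof -
      obtain f g where f: "\<And>n. f n \<in> H" "f \<longlonglongrightarrow> a" and g: "\<And>n. g n \<in> H" "g \<longlonglongrightarrow> b"
        using ab unfolding closure_sequential by metis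
      have "(\<lambda>n. f n ** g n) \<longlonglongrightarrow> a ** b"
        by (intro tendsto_intros f g)
      moreover have "f n ** g n \<in> H" for n
        using f g H(1) by (simp add: is_subgroup_def)
      ultimately show ?thesis
        unfolding closure_sequential by (intro exI[of _ "\<lambda>n. f n ** g n"]) simp
    qed
    show "adj_mat a \<in> closure H" if a: "a \<in> closure H" for a
    proof -
      obtain f where f: "\<And>n. f n \<in> H" "f \<longlonglongrightarrow> a"
        using a unfolding closure_sequential by metis
      have "(\<lambda>n. adj_mat (f n)) \<longlonglongrightarrow> adj_mat a"
        by (intro tendsto_intros f)
      then show ?thesis
        unfolding closure_sequential using adjH f by (intro exI[of _ "\<lambda>n. adj_mat (f n)"]) simp
    qed
  qed (rule un)
  then show ?thesis
    using un by (simp add: compact_unitary_group_def)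
qed

subsection \<open>Groups with the two-eigenvalue property\<close>

lemma mat_mult_mult: "(mat p ** A) ** (mat q ** B) = mat (p * q) ** ((A :: 'n::finite cmat) ** B)"
proof -
  have "(mat p ** A) ** (mat q ** B) = mat p ** (A ** mat q) ** B"
    by (simp only: matrix_mul_assoc)
  also have "\<dots> = mat p ** mat q ** (A ** B)"
    by (simp only: mat_commute[of A q] matrix_mul_assoc)
  finally show ?thesis
    by (simp add: mat_mult_mat)
qed

lemma mat_mult_left: "mat p ** (mat q ** B) = mat (p * q) ** (B :: 'n::finite cmat)"
  using mat_mult_mult[of p "mat 1" q B] by simp

lemma mat_mult_right: "(mat p ** A) ** mat q = mat (p * q) ** (A :: 'n::finite cmat)"
  using mat_mult_mult[of p A q "mat 1"] by simp

lemma mat_left_commute: "A ** (mat c ** B) = mat c ** ((A :: 'n::finite cmat) ** B)"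
  using mat_mult_mult[of 1 A c B] by simp

lemma unitary_conj_mult:
  assumes "unitary_mat k"
  shows "k ** A ** adj_mat k ** (k ** B ** adj_mat k) = k ** (A ** B) ** adj_mat k"
proof -
  have "k ** A ** adj_mat k ** (k ** B ** adj_mat k) = k ** A ** (adj_mat k ** k) ** B ** adj_mat k"
    by (simp only: matrix_mul_assoc)
  also have "\<dots> = k ** A ** B ** adj_mat k"
    using assms by (simp add: unitary_mat_def)
  finally show ?thesis
    by (simp only: matrix_mul_assoc)
qed

lemma mat_mult_cancel: "c \<noteq> 0 \<Longrightarrow> mat c ** A = mat c ** B \<longleftrightarrow> A = (B :: 'n::finite cmat)"
  by (simp add: vec_eq_iff mat_mult_nth)

text \<open>Infinitesimal invariance of the trace form: bracketing with a skew matrix is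
  skew-adjoint. The form takes the place of the Killing form.\<close>

lemma inner_bracket:
  fixes X Z W :: "'n::finite cmat"
  assumes "adj_mat X = - X"
  shows "(Z ** X - X ** Z) \<bullet> W = Z \<bullet> (X ** W - W ** X)"
  by (simp add: inner_diff_left inner_diff_right inner_cmat_mult_right[of Z X]
      inner_cmat_mult_left[of X Z] assms matrix_minus_left matrix_minus_right)

definition ad_proj :: "'n::finite cmat \<Rightarrow> 'n cmat \<Rightarrow> 'n cmat" where
  "ad_proj Q X = mat \<i> ** (Q ** X - X ** Q)"

text \<open>Scalars drop out of brackets, so \<i> Q may be replaced by any element of a Lie algebra
  that differs from it by a scalar.\<close>

lemma ad_proj_shift: "ad_proj Q X = (mat \<i> ** Q - mat c) ** X - X ** (mat \<i> ** Q - mat c)"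
proof -
  have "mat \<i> ** Q ** X = mat \<i> ** (Q ** X)"
    by (simp only: matrix_mul_assoc)
  then show ?thesis
    by (simp add: ad_proj_def matrix_diff_ldistrib matrix_diff_rdistrib mat_commute[of X c] mat_left_commute)
qed

lemma ad_proj_eq_0_iff: "ad_proj Q X = 0 \<longleftrightarrow> Q ** X = X ** Q"
  by (simp add: ad_proj_def vec_eq_iff mat_mult_nth)

lemma ad_proj_conj:
  assumes "unitary_mat k"
  shows "k ** ad_proj Q X ** adj_mat k = ad_proj (k ** Q ** adj_mat k) (k ** X ** adj_mat k)"
proof -
  have "k ** ad_proj Q X ** adj_mat k = mat \<i> ** (k ** (Q ** X - X ** Q) ** adj_mat k)"
    unfolding ad_proj_def mat_left_commute by (simp only: matrix_mul_assoc)
  then show ?thesis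
    by (simp only: ad_proj_def unitary_conj_mult[OF assms])
      (simp only: matrix_diff_ldistrib matrix_diff_rdistrib)
qed

text \<open>For idempotent \<open>Q\<close> this acts as \<open>a\<close> on the image and as \<open>b\<close> on the kernel of \<open>Q\<close>.\<close>

definition two_value :: "complex \<Rightarrow> complex \<Rightarrow> 'n::finite cmat \<Rightarrow> 'n cmat" where
  "two_value a b Q = mat b + mat (a - b) ** Q"

lemma two_value_conj:
  assumes "unitary_mat k"
  shows "k ** two_value a b Q ** adj_mat k = two_value a b (k ** Q ** adj_mat k)"
proof -
  have "k ** two_value a b Q ** adj_mat k = mat b ** (k ** adj_mat k) + mat (a - b) ** (k ** Q ** adj_mat k)"
    unfolding two_value_def matrix_add_ldistrib matrix_add_rdistrib mat_left_commute mat_commute[of k]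
    by (simp only: matrix_mul_assoc)
  then show ?thesis
    using assms by (simp add: two_value_def unitary_mat_def)
qed

lemma two_value_mult:
  assumes Q: "Q ** Q = (Q :: 'n::finite cmat)"
  shows "two_value a b Q ** two_value c d Q = two_value (a * c) (b * d) Q"
proof -
  have "two_value a b Q ** two_value c d Q
      = mat (b * d) + mat ((a - b) * d) ** Q + (mat (b * (c - d)) ** Q + mat ((a - b) * (c - d)) ** Q)"
    by (simp only: two_value_def matrix_add_ldistrib matrix_add_rdistrib mat_mult_mult mat_mult_left
        mat_mult_right mat_mult_mat Q)
  also have "\<dots> = two_value (a * c) (b * d) Q"
    by (simp add: two_value_def vec_eq_iff mat_mult_nth algebra_simps)
  finally show ?thesis .
qed

lemma two_value_1: "two_value 1 1 Q = mat 1"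
  by (simp add: two_value_def matrix_zero_left)

lemma two_value_commute:
  assumes "Q ** X = X ** Q"
  shows "two_value a b Q ** X = X ** two_value a b Q"
proof -
  have "mat c ** Q ** X = mat c ** (X ** Q)" for c
    by (simp only: assms flip: matrix_mul_assoc)
  then show ?thesis
    by (simp add: two_value_def matrix_add_ldistrib matrix_add_rdistrib mat_commute[of X] mat_left_commute)
qed

text \<open>In blocks with respect to \<open>Q\<close>, conjugation fixes the diagonal blocks and
  multiplies the others by w and its conjugate, where w is a times the conjugate of b. On these
  blocks \<open>ad_proj Q\<close> has the eigenvalues 0, \<i> and - \<i>, and the right-hand side is
  the interpolating quadratic polynomial.\<close>

lemma two_value_Ad:
  fixes Q X :: "'n::finite cmat"
  assumes Q: "Q ** Q = Q" and ab: "cmod a = 1" "cmod b = 1"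
  shows "two_value a b Q ** X ** two_value (cnj a) (cnj b) Q
    = X + (1 - Re (a * cnj b)) *\<^sub>R ad_proj Q (ad_proj Q X) + Im (a * cnj b) *\<^sub>R ad_proj Q X"
proof -
  have norm1: "b * cnj b = 1" "a * cnj a = 1"
    using ab by (simp_all add: complex_norm_square[symmetric])
  define w where "w = a * cnj b"
  have w: "cnj a * b = cnj w"
    by (simp add: w_def mult.commute)
  have "two_value a b Q ** X ** two_value (cnj a) (cnj b) Q
      = (mat b ** X + mat (a - b) ** (Q ** X)) ** (mat (cnj b) + mat (cnj a - cnj b) ** Q)"
    by (simp add: two_value_def matrix_add_rdistrib matrix_mul_assoc)
  also have "\<dots> = mat (b * cnj b) ** X + mat ((a - b) * cnj b) ** (Q ** X)
      + (mat (b * (cnj a - cnj b)) ** (X ** Q) + mat ((a - b) * (cnj a - cnj b)) ** (Q ** X ** Q))"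
    by (simp only: matrix_add_ldistrib matrix_add_rdistrib mat_mult_mult mat_mult_right)
  also have "\<dots> = X + mat (w - 1) ** (Q ** X) + (mat (cnj w - 1) ** (X ** Q) + mat (2 - w - cnj w) ** (Q ** X ** Q))"
  proof -
    have "(a - b) * cnj b = w - 1" "b * (cnj a - cnj b) = cnj w - 1" "(a - b) * (cnj a - cnj b) = 2 - w - cnj w"
      using norm1 w by (simp_all add: w_def algebra_simps)
    then show ?thesis
      by (simp add: norm1)
  qed
  also have "\<dots> = X + (1 - Re w) *\<^sub>R ad_proj Q (ad_proj Q X) + Im w *\<^sub>R ad_proj Q X"
  proof -
    have QQ: "Q ** (Q ** X) = Q ** X" "X ** Q ** Q = X ** Q"
      using Q by (simp_all add: matrix_mul_assoc) (simp add: Q flip: matrix_mul_assoc)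
    have "Q ** (mat \<i> ** E) - mat \<i> ** E ** Q = mat \<i> ** (Q ** E - E ** Q)" for E
      by (simp only: mat_left_commute[of Q] matrix_diff_ldistrib matrix_mul_assoc[of _ E Q])
    then have "ad_proj Q (ad_proj Q X) = mat \<i> ** (mat \<i> ** (Q ** (Q ** X - X ** Q) - (Q ** X - X ** Q) ** Q))"
      by (simp only: ad_proj_def)
    also have "\<dots> = mat \<i> ** (mat \<i> ** (Q ** X - Q ** X ** Q - (Q ** X ** Q - X ** Q)))"
      by (simp only: matrix_diff_ldistrib matrix_diff_rdistrib QQ matrix_mul_assoc[of Q X Q])
    finally have ad2: "ad_proj Q (ad_proj Q X) = mat \<i> ** (mat \<i> ** (Q ** X - Q ** X ** Q - (Q ** X ** Q - X ** Q)))" .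
    have re: "complex_of_real (Re w) = (w + cnj w) / 2" and im: "\<i> * complex_of_real (Im w) = (w - cnj w) / 2"
      by (simp_all add: complex_eq_iff)
    \<comment> \<open>The letters stand for corresponding entries of X, Q X, X Q and Q X Q.\<close>
    have entry: "A + (w - 1) * B + ((cnj w - 1) * C + (2 - w - cnj w) * D)
        = A + (1 - Re w) *\<^sub>R (\<i> * (\<i> * (B - D - (D - C)))) + Im w *\<^sub>R (\<i> * (B - C))" for A B C D
    proof -
      have "Im w *\<^sub>R (\<i> * (B - C)) = (\<i> * complex_of_real (Im w)) * (B - C)"
        by (simp add: scaleR_conv_of_real)
      then have 1: "Im w *\<^sub>R (\<i> * (B - C)) = (w - cnj w) / 2 * (B - C)"
        by (simp only: im)
      have "(1 - Re w) *\<^sub>R (\<i> * (\<i> * (B - D - (D - C)))) = - (1 - complex_of_real (Re w)) * (B - D - (D - C))"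
        by (simp add: scaleR_conv_of_real flip: mult.assoc) (simp add: algebra_simps)
      then have 2: "(1 - Re w) *\<^sub>R (\<i> * (\<i> * (B - D - (D - C)))) = - (1 - (w + cnj w) / 2) * (B - D - (D - C))"
        by (simp only: re)
      show ?thesis
        unfolding 1 2 by (simp add: field_simps)
    qed
    show ?thesis
      unfolding ad2 unfolding ad_proj_def[of Q X]
      by (simp only: vec_eq_iff vector_add_component vector_scaleR_component vector_minus_component
          mat_mult_nth entry) simp
  qed
  finally show ?thesis
    by (simp add: w_def)
qed

section \<open>Traces, determinants and commutator subgroups\<close>

lemma trace_scaleR: "trace (r *\<^sub>R A) = r *\<^sub>R trace (A :: 'n::finite cmat)"
  by (simp add: trace_def scaleR_sum_right)

lemma trace_mat: "trace (mat c :: 'n::finite cmat) = of_nat CARD('n) * c"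
  by (simp add: trace_def mat_def)

lemma trace_ad_proj: "trace (ad_proj Q X) = 0"
proof -
  have "trace (mat \<i> ** A) = \<i> * trace A" for A :: "'a::finite cmat"
    by (simp add: trace_def mat_mult_nth sum_distrib_left)
  then show ?thesis
    by (simp add: ad_proj_def trace_sub trace_mul_sym[of X Q])
qed

lemma det_mat: "det (mat c :: 'n::finite cmat) = c ^ CARD('n)"
  by (subst det_diagonal) (simp_all add: mat_def)

lemma det_inverse_mult:
  fixes a :: "'n::finite cmat"
  assumes "unitary_mat a"
  shows "det a * det (adj_mat a) = 1"
  using assms by (metis det_I det_mul unitary_mat_def)

lemma commutator_subgroup_sub:
  assumes "is_subgroup K"
  shows "commutator_subgroup K \<subseteq> K"
  unfolding commutator_subgroup_def
  by (rule gen_subgroup_least[OF assms]) (use assms in \<open>auto simp: is_subgroup_def\<close>)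

lemma is_subgroup_commutator_subgroup:
  assumes "is_subgroup K"
  shows "is_subgroup (commutator_subgroup K)"
  unfolding commutator_subgroup_def
  by (rule is_subgroup_gen_subgroup[OF assms]) (use assms in \<open>auto simp: is_subgroup_def\<close>)

lemma det_commutator_subgroup:
  fixes K :: "'n::finite cmat set"
  assumes un: "\<And>a. a \<in> K \<Longrightarrow> unitary_mat a" and h: "h \<in> commutator_subgroup K"
  shows "det h = 1"
proof -
  let ?T = "{a :: 'n cmat. unitary_mat a \<and> det a = 1}"
  have "is_subgroup ?T"
  proof (rule is_subgroup_unitaryI)
    fix a assume a: "a \<in> ?T"
    then show "adj_mat a \<in> ?T"
      using det_inverse_mult[of a] by (auto simp: unitary_mat_def)
  qed (auto simp: unitary_1 unitary_mult det_mul)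
  moreover have "a ** b ** matrix_inv a ** matrix_inv b \<in> ?T" if "a \<in> K" "b \<in> K" for a b
  proof -
    have "unitary_mat (adj_mat a)" "unitary_mat (adj_mat b)"
      using un that by (auto simp: unitary_mat_def)
    moreover have "det a * det b * det (adj_mat a) * det (adj_mat b) = (det a * det (adj_mat a)) * (det b * det (adj_mat b))"
      by (simp only: mult_ac)
    ultimately show ?thesis
      using un that by (simp add: unitary_inv unitary_mult det_mul det_inverse_mult)
  qed
  ultimately have "commutator_subgroup K \<subseteq> ?T"
    unfolding commutator_subgroup_def by (intro gen_subgroup_least) auto
  then show ?thesis
    using h by blast
qed

text \<open>The commutators form a continuous image of the connected set K \<times> K and contain
  the identity, so they lie in the identity component of the group they generate.\<close>

lemma connected_commutator_subgroup:
  fixes K :: "'n::finite cmat set"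
  assumes K: "is_subgroup K" "connected K" and un: "\<And>a. a \<in> K \<Longrightarrow> unitary_mat a"
  shows "connected (commutator_subgroup K)"
proof -
  let ?H = "commutator_subgroup K"
  let ?C = "{a ** b ** matrix_inv a ** matrix_inv b | a b. a \<in> K \<and> b \<in> K}"
  have H: "is_subgroup ?H" "?H \<subseteq> K"
    using is_subgroup_commutator_subgroup[OF K(1)] commutator_subgroup_sub[OF K(1)] by auto
  have C: "?C = (\<lambda>(a, b). a ** b ** adj_mat a ** adj_mat b) ` (K \<times> K)"
  proof -
    have "a ** b ** matrix_inv a ** matrix_inv b = a ** b ** adj_mat a ** adj_mat b" if "a \<in> K" "b \<in> K" for a b
      using un that by (simp add: unitary_inv)
    then show ?thesis
      by (auto simp: image_iff) metis+
  qed
  have "?C \<subseteq> identity_component ?H"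
  proof (rule connected_subset_identity_component)
    show "connected ?C"
      unfolding C case_prod_beta
      by (intro connected_continuous_image connected_Times K continuous_intros)
    show "?C \<subseteq> ?H"
      unfolding commutator_subgroup_def by (rule gen_subgroup_superset)
    have "mat 1 \<in> K"
      using K by (simp add: is_subgroup_def)
    then show "mat 1 \<in> ?C"
      unfolding C by (intro image_eqI[of _ _ "(mat 1, mat 1)"]) auto
  qed
  moreover have "is_subgroup (identity_component ?H)"
    by (rule is_subgroup_identity_component) (use H un in auto)
  ultimately have "?H \<subseteq> identity_component ?H"
    unfolding commutator_subgroup_def[of K] by (intro gen_subgroup_least) auto
  then have "?H = identity_component ?H"
    using identity_component_subset by blast
  then show ?thesis
    by (metis connected_connected_component identity_component_def)
qed

section \<open>Topological generation by the conjugates of one projection\<close>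

locale two_eigenvalue_group =
  fixes G :: "'n::finite cmat set" and P :: "'n cmat" and l m :: complex
  assumes G: "compact_unitary_group G" and irr: "irreducible_rep G"
    and P: "P ** P = P" and lm: "cmod l = 1" "cmod m = 1" "l \<noteq> m" "l \<noteq> - m"
    and gG: "two_value l m P \<in> G"
    and gen: "G \<subseteq> closure (gen_subgroup (conj_class G (two_value l m P)))"
    and noncentral: "\<exists>X\<in>lie_algebra G. \<exists>k\<in>G. k ** X \<noteq> X ** k"
begin

abbreviation L :: "'n cmat set" where "L \<equiv> lie_algebra G"

definition projs :: "'n cmat set" where
  "projs = {k ** P ** adj_mat k | k. k \<in> G}"

lemma G_subgroup: "is_subgroup G" and G_closed: "closed G" and G_unitary: "k \<in> G \<Longrightarrow> unitary_mat k"
  using G by (auto simp: compact_unitary_group_def)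

lemma G_1: "mat 1 \<in> G" and G_mult: "a \<in> G \<Longrightarrow> b \<in> G \<Longrightarrow> a ** b \<in> G"
  using G_subgroup by (auto simp: is_subgroup_def)

lemma G_adj: "k \<in> G \<Longrightarrow> adj_mat k \<in> G"
  using G_subgroup unitary_inv[OF G_unitary] by (auto simp: is_subgroup_def)

lemma conj_mult: "k \<in> G \<Longrightarrow> k ** A ** adj_mat k ** (k ** B ** adj_mat k) = k ** (A ** B) ** adj_mat k"
  by (rule unitary_conj_mult[OF G_unitary])

lemma conj_inverse: "k \<in> G \<Longrightarrow> k ** (adj_mat k ** A ** k) ** adj_mat k = A"
proof -
  assume k: "k \<in> G"
  have "k ** (adj_mat k ** A ** k) ** adj_mat k = (k ** adj_mat k) ** A ** (k ** adj_mat k)"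
    by (simp only: matrix_mul_assoc)
  then show ?thesis
    using G_unitary[OF k] by (simp add: unitary_mat_def)
qed

lemma P_projs: "P \<in> projs"
  unfolding projs_def using G_1 by force

lemma projs_conj: "k \<in> G \<Longrightarrow> Q \<in> projs \<Longrightarrow> k ** Q ** adj_mat k \<in> projs"
proof -
  assume k: "k \<in> G" and "Q \<in> projs"
  then obtain h where h: "h \<in> G" "Q = h ** P ** adj_mat h"
    by (auto simp: projs_def)
  have "k ** Q ** adj_mat k = (k ** h) ** P ** adj_mat (k ** h)"
    by (simp add: h adj_mult matrix_mul_assoc)
  then show ?thesis
    unfolding projs_def using G_mult[OF k h(1)] by blast
qed

lemma projs_idem: "Q \<in> projs \<Longrightarrow> Q ** Q = Q"
  using conj_mult P by (auto simp: projs_def)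

lemma conj_class_eq: "conj_class G (two_value l m P) = two_value l m ` projs"
proof -
  have "h ** two_value l m P ** matrix_inv h = two_value l m (h ** P ** adj_mat h)" if "h \<in> G" for h
    using that by (simp add: unitary_inv G_unitary two_value_conj)
  then show ?thesis
    by (force simp: conj_class_def projs_def)
qed

lemma two_value_G: "Q \<in> projs \<Longrightarrow> two_value l m Q \<in> G"
proof -
  assume "Q \<in> projs"
  then obtain h where h: "h \<in> G" "Q = h ** P ** adj_mat h"
    by (auto simp: projs_def)
  then show ?thesis
    using G_mult[OF G_mult[OF h(1) gG] G_adj[OF h(1)]] by (simp add: two_value_conj[OF G_unitary])
qed

text \<open>That \<open>Q\<close> is Hermitian is not part of the setting; the adjoint is identified
  as the inverse, which idempotence makes explicit.\<close>

lemma adj_two_value: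
  assumes Q: "Q \<in> projs" and ab: "cmod a = 1" "cmod b = 1" and G: "two_value a b Q \<in> G"
  shows "adj_mat (two_value a b Q) = two_value (cnj a) (cnj b) Q"
proof -
  let ?g = "two_value a b Q" and ?h = "two_value (cnj a) (cnj b) Q"
  have "?g ** ?h = mat 1"
    using ab by (simp add: two_value_mult[OF projs_idem[OF Q]] complex_norm_square[symmetric] two_value_1)
  then have "adj_mat ?g = adj_mat ?g ** ?g ** ?h"
    by (simp flip: matrix_mul_assoc)
  then show ?thesis
    using G_unitary[OF G] by (simp add: unitary_mat_def)
qed

text \<open>Induction over topological generation. The generator case allows arbitrary unit values a
  and b, so that it covers the inverses of the generators, which have conjugate values.\<close>

lemma G_induct:
  assumes "k \<in> G" and gens: "\<And>Q a b. Q \<in> projs \<Longrightarrow> cmod a = 1 \<Longrightarrow> cmod b = 1 \<Longrightarrow> two_value a b Q \<in> G \<Longrightarrow> p (two_value a b Q)"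
    and one: "p (mat 1)" and mult: "\<And>a b. a \<in> G \<Longrightarrow> b \<in> G \<Longrightarrow> p a \<Longrightarrow> p b \<Longrightarrow> p (a ** b)"
    and cl: "closed {k. p k}"
  shows "p k"
proof -
  \<comment> \<open>Requiring the property for the adjoint as well makes the set closed under
    inversion.\<close>
  let ?T = "G \<inter> {k. p k} \<inter> adj_mat -` {k. p k}"
  have "is_subgroup ?T"
    by (rule is_subgroup_unitaryI) (auto simp: G_1 G_mult G_adj G_unitary one mult adj_mult)
  moreover have "closed ?T"
    using G_closed cl by (intro closed_Int closed_vimage continuous_intros) auto
  moreover have "conj_class G (two_value l m P) \<subseteq> ?T"
  proof -
    have "two_value l m Q \<in> ?T" if "Q \<in> projs" for Q
      using two_value_G[OF that] G_adj[OF two_value_G[OF that]] lm gens[OF that, of l m] gens[OF that, of "cnj l" "cnj m"]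
      by (simp add: adj_two_value[OF that lm(1,2) two_value_G[OF that]])
    then show ?thesis
      by (auto simp: conj_class_eq)
  qed
  ultimately have "closure (gen_subgroup (conj_class G (two_value l m P))) \<subseteq> ?T"
    by (intro closure_minimal gen_subgroup_least)
  then show ?thesis
    using gen \<open>k \<in> G\<close> by blast
qed

lemma projs_stable_trivial:
  assumes W: "complex_subspace W" and stable: "\<And>Q w. Q \<in> projs \<Longrightarrow> w \<in> W \<Longrightarrow> Q *v w \<in> W"
  shows "W = {0} \<or> W = UNIV"
proof -
  have "\<forall>w\<in>W. k *v w \<in> W" if "k \<in> G" for k
    using that
  proof (rule G_induct)
    fix Q a b assume Q: "Q \<in> projs"
    show "\<forall>w\<in>W. two_value a b Q *v w \<in> W"
    proof
      fix w assume w: "w \<in> W"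
      then have "b *s w \<in> W" "(a - b) *s (Q *v w) \<in> W"
        using W stable[OF Q w] unfolding complex_subspace_def by blast+
      then have "b *s w + (a - b) *s (Q *v w) \<in> W"
        using W unfolding complex_subspace_def by blast
      then show "two_value a b Q *v w \<in> W"
        by (simp add: two_value_def matrix_vector_mult_add_rdistrib mat_mult_vec flip: matrix_vector_mul_assoc)
    qed
  next
    have eq: "{k. \<forall>w\<in>W. k *v w \<in> W} = (\<Inter>w\<in>W. (\<lambda>k. k *v w) -` W)"
      by auto
    have "continuous_on UNIV (\<lambda>k. k *v w)" for w :: "complex^'n"
      by (rule linear_continuous_on[OF bounded_linear_mult_vec])
    then show "closed {k. \<forall>w\<in>W. k *v w \<in> W}"
      unfolding eq by (intro closed_INT ballI closed_vimage closed_subspace complex_subspace_imp_subspace W)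
  qed (simp_all flip: matrix_vector_mul_assoc)
  then show ?thesis
    using irr W unfolding irreducible_rep_def by blast
qed

lemma projs_commute_imp_G_commute:
  assumes comm: "\<And>Q. Q \<in> projs \<Longrightarrow> Q ** X = X ** Q" and "k \<in> G"
  shows "k ** X = X ** k"
  using assms(2)
proof (rule G_induct)
  fix a b assume ab: "a ** X = X ** a" "b ** X = X ** b"
  have "a ** b ** X = a ** (b ** X)"
    by (simp only: matrix_mul_assoc)
  also have "\<dots> = (a ** X) ** b"
    by (simp only: ab(2) matrix_mul_assoc)
  finally show "a ** b ** X = X ** (a ** b)"
    by (simp only: ab(1) matrix_mul_assoc)
next
  show "closed {k. k ** X = X ** k}"
    by (intro closed_Collect_eq continuous_intros)
next
  fix Q a b assume "Q \<in> projs"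
  then show "two_value a b Q ** X = X ** two_value a b Q"
    by (intro two_value_commute comm)
qed simp

text \<open>By \<open>two_value_Ad\<close>, conjugation by a generator is a polynomial in
  \<open>ad_proj Q\<close>. No exponential enters, so the components of \<open>G\<close> away from
  the identity are covered.\<close>

lemma ad_proj_stable_imp_Ad_stable:
  assumes I: "subspace I" and stable: "\<And>Q X. Q \<in> projs \<Longrightarrow> X \<in> I \<Longrightarrow> ad_proj Q X \<in> I"
    and "k \<in> G" "X \<in> I"
  shows "k ** X ** adj_mat k \<in> I"
proof -
  have "\<forall>X\<in>I. k ** X ** adj_mat k \<in> I"
    using assms(3)
  proof (rule G_induct)
    fix Q a b assume Q: "Q \<in> projs" and ab: "cmod a = 1" "cmod b = 1" and G: "two_value a b Q \<in> G"
    show "\<forall>X\<in>I. two_value a b Q ** X ** adj_mat (two_value a b Q) \<in> I"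
      unfolding adj_two_value[OF Q ab G] two_value_Ad[OF projs_idem[OF Q] ab]
      using I by (auto intro!: subspace_add subspace_scale stable Q)
  next
    fix a b assume ab: "\<forall>X\<in>I. a ** X ** adj_mat a \<in> I" "\<forall>X\<in>I. b ** X ** adj_mat b \<in> I"
    then have "\<forall>X\<in>I. a ** (b ** X ** adj_mat b) ** adj_mat a \<in> I"
      by blast
    then show "\<forall>X\<in>I. a ** b ** X ** adj_mat (a ** b) \<in> I"
      by (simp add: adj_mult matrix_mul_assoc)
  next
    have eq: "{k. \<forall>X\<in>I. k ** X ** adj_mat k \<in> I} = (\<Inter>X\<in>I. (\<lambda>k. k ** X ** adj_mat k) -` I)"
      by auto
    show "closed {k. \<forall>X\<in>I. k ** X ** adj_mat k \<in> I}"
      unfolding eq by (intro closed_INT ballI closed_vimage closed_subspace I continuous_intros)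
  qed simp
  then show ?thesis
    using assms(4) by blast
qed

section \<open>The Lie algebra of the group and its commutant\<close>

lemma L_subspace: "subspace L"
  by (rule subspace_lie_algebra[OF G])

lemma L_skew: "X \<in> L \<Longrightarrow> adj_mat X = - X"
  using lie_algebra_skew G_unitary by blast

lemma L_Ad: "k \<in> G \<Longrightarrow> X \<in> L \<Longrightarrow> k ** X ** adj_mat k \<in> L"
  by (rule lie_algebra_Ad) (auto simp: G_unitary G_mult G_adj)

lemma Ad_stable_imp_bracket:
  assumes S: "subspace S" and Ad: "\<And>k Y. k \<in> G \<Longrightarrow> Y \<in> S \<Longrightarrow> k ** Y ** adj_mat k \<in> S"
    and X: "X \<in> L" and Y: "Y \<in> S"
  shows "X ** Y - Y ** X \<in> S"
proof (rule bracket_in_subspace[OF S Y])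
  fix t
  have "mexp (- (t *\<^sub>R X)) = adj_mat (mexp (t *\<^sub>R X))"
    by (simp add: mexp_adj adj_scaleR L_skew[OF X])
  then show "mexp (t *\<^sub>R X) ** Y ** mexp (- (t *\<^sub>R X)) \<in> S"
    using Ad Y X by (simp add: lie_algebra_def)
qed

lemma L_bracket: "X \<in> L \<Longrightarrow> Y \<in> L \<Longrightarrow> X ** Y - Y ** X \<in> L"
  by (rule Ad_stable_imp_bracket[OF L_subspace L_Ad])

text \<open>This is where the ratio \<open>- 1\<close> must be excluded: \<open>w = l / m\<close> is not real.\<close>

lemma ad_proj_L:
  assumes Q: "Q \<in> projs" and X: "X \<in> L"
  shows "ad_proj Q X \<in> L"
proof -
  define w where "w = l * cnj m"
  have "Im w \<noteq> 0"
  proof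
    assume "Im w = 0"
    moreover have "cmod w = 1"
      using lm by (simp add: w_def norm_mult)
    ultimately have "w = 1 \<or> w = -1"
      by (auto simp: complex_eq_iff cmod_def)
    moreover have "w * m = l"
      using lm(2) by (simp add: w_def mult.assoc mult.commute[of "cnj m"] complex_norm_square[symmetric])
    ultimately show False
      using lm by auto
  qed
  let ?g = "two_value l m Q" and ?h = "two_value (cnj l) (cnj m) Q"
  have "?g ** X ** ?h \<in> L" "?h ** X ** ?g \<in> L"
    using L_Ad[OF two_value_G[OF Q] X] L_Ad[OF G_adj[OF two_value_G[OF Q]] X]
    by (simp_all add: adj_two_value[OF Q lm(1,2) two_value_G[OF Q], symmetric])
  then have "?g ** X ** ?h - ?h ** X ** ?g \<in> L"
    by (rule subspace_diff[OF L_subspace])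
  moreover have "?g ** X ** ?h - ?h ** X ** ?g = (2 * Im w) *\<^sub>R ad_proj Q X"
  proof -
    have "?g ** X ** ?h = X + (1 - Re w) *\<^sub>R ad_proj Q (ad_proj Q X) + Im w *\<^sub>R ad_proj Q X"
      unfolding w_def by (rule two_value_Ad[OF projs_idem[OF Q] lm(1,2)])
    moreover have "?h ** X ** ?g = X + (1 - Re w) *\<^sub>R ad_proj Q (ad_proj Q X) + (- Im w) *\<^sub>R ad_proj Q X"
      using two_value_Ad[OF projs_idem[OF Q], of "cnj l" "cnj m" X] lm by (simp add: w_def)
    moreover have "(2 * Im w) *\<^sub>R ad_proj Q X = Im w *\<^sub>R ad_proj Q X + Im w *\<^sub>R ad_proj Q X"
      by (simp only: mult_2 scaleR_add_left)
    ultimately show ?thesis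
      by simp
  qed
  ultimately have "(2 * Im w) *\<^sub>R ad_proj Q X \<in> L"
    by simp
  from subspace_scale[OF L_subspace this, of "1 / (2 * Im w)"] show ?thesis
    using \<open>Im w \<noteq> 0\<close> by simp
qed

lemma commute_conj:
  assumes "k \<in> G" "A ** B = B ** A"
  shows "k ** A ** adj_mat k ** (k ** B ** adj_mat k) = k ** B ** adj_mat k ** (k ** A ** adj_mat k)"
  using assms by (simp add: conj_mult)

text \<open>The commutant of a set stable under conjugation is itself stable: move the conjugation
  from \<open>A\<close> to \<open>X\<close>.\<close>

lemma Ad_stable_commute:
  assumes S: "\<And>k X. k \<in> G \<Longrightarrow> X \<in> S \<Longrightarrow> k ** X ** adj_mat k \<in> S"
    and A: "\<And>X. X \<in> S \<Longrightarrow> A ** X = X ** A" and k: "k \<in> G" and X: "X \<in> S"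
  shows "k ** A ** adj_mat k ** X = X ** (k ** A ** adj_mat k)"
proof -
  have "adj_mat k ** X ** k \<in> S"
    using S[OF G_adj[OF k] X] by simp
  from commute_conj[OF k A[OF this]] show ?thesis
    by (simp add: conj_inverse[OF k])
qed

lemma P_commute_imp_G_commute:
  assumes S: "\<And>k X. k \<in> G \<Longrightarrow> X \<in> S \<Longrightarrow> k ** X ** adj_mat k \<in> S"
    and P: "\<And>X. X \<in> S \<Longrightarrow> P ** X = X ** P" and "k \<in> G" "X \<in> S"
  shows "k ** X = X ** k"
proof (rule projs_commute_imp_G_commute[OF _ assms(3)])
  fix Q assume "Q \<in> projs"
  then obtain h where h: "h \<in> G" "Q = h ** P ** adj_mat h"
    by (auto simp: projs_def)
  show "Q ** X = X ** Q"
    unfolding h(2) by (rule Ad_stable_commute[OF S P h(1) assms(4)])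
qed

text \<open>Otherwise all conjugates of \<open>P\<close>, and with them all of \<open>G\<close>,
  would commute with \<open>L\<close>, against \<open>noncentral\<close>. In this form the positive
  dimension of G/Z(G) enters.\<close>

lemma P_not_commute_L: "\<exists>X\<in>L. P ** X \<noteq> X ** P"
  using P_commute_imp_G_commute[OF L_Ad] noncentral by blast

text \<open>The eigenvalues of \<i> P are among 0 and \<i>; this is the quadratic relation asked for
  by \<open>commuting_sum_scalar\<close>.\<close>

lemma iP_square: "(mat \<i> ** P) ** (mat \<i> ** P) = mat \<i> ** (mat \<i> ** P)"
  by (simp add: mat_mult_mult P) (simp add: matrix_mul_assoc mat_mult_mat)

lemma iP_commute_imp: "(mat \<i> ** Q) ** X = X ** (mat \<i> ** Q) \<Longrightarrow> Q ** X = X ** Q"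
  using mat_mult_mult[of 1 X \<i> Q] mat_mult_cancel[of \<i> "Q ** X" "X ** Q"] by (simp add: matrix_mul_assoc)

lemma i_stable: "complex_subspace W \<Longrightarrow> (mat \<i> ** Q) *v w \<in> W \<Longrightarrow> Q *v w \<in> W"
proof -
  assume W: "complex_subspace W" "(mat \<i> ** Q) *v w \<in> W"
  then have "(- \<i>) *s ((mat \<i> ** Q) *v w) \<in> W"
    unfolding complex_subspace_def by blast
  then show ?thesis
    by (simp add: mat_mult_vec flip: matrix_vector_mul_assoc)
qed

text \<open>The orthogonal projection of \<open>\<i> P\<close> to \<open>L\<close> differs from \<open>\<i> P\<close> by an element of the
  commutant of \<open>L\<close>, and the latter is scalar since \<open>\<i> P\<close> has only two eigenvalues.\<close>

lemma iP_in_L_up_to_scalar: "\<exists>c. mat \<i> ** P - mat c \<in> L"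
proof -
  obtain Y Z where Y: "Y \<in> L" and Z: "\<And>X. X \<in> L \<Longrightarrow> Z \<bullet> X = 0" and YZ: "mat \<i> ** P = Y + Z"
    using orthogonal_subspace_decomp_exists[of L "mat \<i> ** P"] L_subspace
    by (metis orthogonal_def span_base span_eq_iff)
  have ZL: "Z ** X = X ** Z" if X: "X \<in> L" for X
  proof -
    have "ad_proj P X = (Y + Z) ** X - X ** (Y + Z)"
      using ad_proj_shift[of P X 0] by (simp add: YZ)
    then have "Z ** X - X ** Z = ad_proj P X - (Y ** X - X ** Y)"
      by (simp add: matrix_ring_simps)
    then have in_L: "Z ** X - X ** Z \<in> L"
      using subspace_diff[OF L_subspace ad_proj_L[OF P_projs X] L_bracket[OF Y X]] by simp
    \<comment> \<open>The squared norm of [Z, X] is the product of Z with [X, [Z, X]], an element of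
      \<open>L\<close>.\<close>
    have "(Z ** X - X ** Z) \<bullet> (Z ** X - X ** Z) = 0"
      unfolding inner_bracket[OF L_skew[OF X], of Z "Z ** X - X ** Z"]
      by (rule Z[OF L_bracket[OF X in_L]])
    then show ?thesis
      by simp
  qed
  \<comment> \<open>The whole commutant is used because it contains every conjugate of
    \<open>Z\<close>. A subspace stable under \<open>L\<close> and \<open>?T\<close> is then stable
    under each conjugate of \<i> P.\<close>
  let ?T = "{B. \<forall>A\<in>L. B ** A = A ** B}"
  have "irreducible_rep (L \<union> ?T)"
    unfolding irreducible_rep_def
  proof (intro allI impI)
    fix W assume W: "complex_subspace W \<and> (\<forall>g\<in>L \<union> ?T. \<forall>w\<in>W. g *v w \<in> W)"
    show "W = {0} \<or> W = UNIV"
    proof (rule projs_stable_trivial)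
      fix Q w assume "Q \<in> projs" and w: "w \<in> W"
      then obtain k where k: "k \<in> G" "Q = k ** P ** adj_mat k"
        by (auto simp: projs_def)
      have "k ** (mat \<i> ** P) ** adj_mat k = mat \<i> ** Q"
        using mat_mult_mult[of 1 k \<i> P] by (simp add: k(2) matrix_mul_assoc)
      then have iQ: "mat \<i> ** Q = k ** Y ** adj_mat k + k ** Z ** adj_mat k"
        by (simp add: YZ matrix_ring_simps)
      have "k ** Y ** adj_mat k \<in> L"
        by (rule L_Ad[OF k(1) Y])
      moreover have "k ** Z ** adj_mat k \<in> ?T"
        using Ad_stable_commute[OF L_Ad ZL k(1)] by auto
      ultimately have "(mat \<i> ** Q) *v w \<in> W"
        using W w by (simp add: iQ matrix_vector_mult_add_rdistrib complex_subspace_def)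
      then show "Q *v w \<in> W"
        using W i_stable by blast
    qed (use W in blast)
  qed
  moreover have "(Y + Z) ** (Y + Z) = mat \<i> ** (Y + Z)"
    using iP_square by (simp add: YZ)
  ultimately have "(\<exists>c. Y = mat c) \<or> (\<exists>c. Z = mat c)"
    using Y ZL L_skew[OF Y] by (intro commuting_sum_scalar[of L ?T]) auto
  \<comment> \<open>If the component in \<open>L\<close> were scalar, \<i> P would commute with
    \<open>L\<close> along with \<open>Z\<close>.\<close>
  moreover have False if "Y = mat c" for c
  proof -
    have "P ** X = X ** P" if "X \<in> L" for X
      by (rule iP_commute_imp) (simp add: YZ \<open>Y = mat c\<close> matrix_ring_simps ZL[OF that] mat_commute)
    then show False
      using P_not_commute_L by blast
  qed
  ultimately obtain c where "Z = mat c"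
    by blast
  then have "mat \<i> ** P - mat c = Y"
    by (simp add: YZ)
  then show ?thesis
    using Y by blast
qed

text \<open>One scalar serves all conjugates of \<open>P\<close>, because conjugation fixes scalar
  matrices.\<close>

definition shift :: complex where
  "shift = (SOME c. mat \<i> ** P - mat c \<in> L)"

definition gen_elem :: "'n cmat \<Rightarrow> 'n cmat" where
  "gen_elem Q = mat \<i> ** Q - mat shift"

lemma gen_elem_L:
  assumes "Q \<in> projs"
  shows "gen_elem Q \<in> L"
proof -
  obtain k where k: "k \<in> G" "Q = k ** P ** adj_mat k"
    using assms by (auto simp: projs_def)
  have "mat \<i> ** P - mat shift \<in> L"
    unfolding shift_def by (rule someI_ex[OF iP_in_L_up_to_scalar])
  then have "k ** (mat \<i> ** P - mat shift) ** adj_mat k \<in> L"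
    by (rule L_Ad[OF k(1)])
  moreover have "k ** (mat \<i> ** P) = mat \<i> ** (k ** P)"
    using mat_mult_mult[of 1 k \<i> P] by simp
  moreover have "mat shift ** k ** adj_mat k = mat shift"
    using G_unitary[OF k(1)] by (simp add: unitary_mat_def flip: matrix_mul_assoc)
  ultimately show ?thesis
    by (simp add: gen_elem_def k(2) matrix_diff_ldistrib matrix_diff_rdistrib mat_commute[of k shift] matrix_mul_assoc)
qed

lemma ad_proj_gen_elem: "ad_proj Q X = gen_elem Q ** X - X ** gen_elem Q"
  unfolding gen_elem_def by (rule ad_proj_shift)

lemma iQ_eq: "mat \<i> ** Q = gen_elem Q + mat shift"
  by (simp add: gen_elem_def)

text \<open>Each \<i> Q is an element of \<open>L\<close> plus a scalar, so an
  \<open>L\<close>-stable subspace is stable under all conjugates of \<open>P\<close>.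
  Irreducibility thus descends from the possibly disconnected group to its Lie algebra.\<close>

lemma L_irreducible: "irreducible_rep L"
  unfolding irreducible_rep_def
proof (intro allI impI)
  fix W assume W: "complex_subspace W \<and> (\<forall>g\<in>L. \<forall>w\<in>W. g *v w \<in> W)"
  show "W = {0} \<or> W = UNIV"
  proof (rule projs_stable_trivial)
    fix Q w assume "Q \<in> projs" "w \<in> W"
    then have "(mat \<i> ** Q) *v w \<in> W"
      using W gen_elem_L by (simp add: iQ_eq matrix_vector_mult_add_rdistrib mat_mult_vec complex_subspace_def)
    then show "Q *v w \<in> W"
      using W i_stable by blast
  qed (use W in blast)
qed

lemma mexp_gen_elem:
  assumes Q: "Q \<in> projs"
  shows "mexp (t *\<^sub>R gen_elem Q) = mat (exp (- t * shift)) ** two_value (exp (\<i> * t)) 1 Q"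
proof -
  have "t *\<^sub>R gen_elem Q = mat (- t * shift) + mat (\<i> * t) ** Q"
    by (simp add: vec_eq_iff gen_elem_def mat_mult_nth)
      (simp add: mat_def scaleR_conv_of_real algebra_simps)
  moreover have "mat (- t * shift) ** (mat (\<i> * t) ** Q) = mat (\<i> * t) ** Q ** mat (- t * shift)"
    by (simp only: mat_commute[of _ "- t * shift"])
  ultimately have "mexp (t *\<^sub>R gen_elem Q) = mexp (mat (- t * shift)) ** mexp (mat (\<i> * t) ** Q)"
    by (simp only: mexp_add_commuting)
  then show ?thesis
    by (simp add: mexp_mat mexp_idempotent[OF projs_idem[OF Q]] two_value_def)
qed

section \<open>The factorisation of the group by its identity component and center\<close>

abbreviation G0 :: "'n cmat set" where "G0 \<equiv> identity_component G"

lemma G0_subgroup: "is_subgroup G0"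
  by (rule is_subgroup_identity_component[OF G_subgroup G_unitary])

lemma G0_sub: "G0 \<subseteq> G"
  by (rule identity_component_subset)

lemma compact_center: "compact (center G)"
proof -
  have eq: "center G = G \<inter> (\<Inter>g\<in>G. {z. z ** g = g ** z})"
    by (auto simp: center_def)
  have "closed (\<Inter>g\<in>G. {z. z ** g = g ** z})"
    by (intro closed_INT ballI closed_Collect_eq continuous_intros)
  then show ?thesis
    unfolding eq using compact_compact_unitary_group[OF G] by (simp add: compact_Int_closed)
qed

text \<open>The product of identity component and center is a subgroup because the center commutes
  with everything, and closed as a continuous image of a compact set; it remains to factor the
  generators.\<close>

lemma G_eq_G0_center: "G = {a ** z | a z. a \<in> G0 \<and> z \<in> center G}"
proof
  let ?T = "{a ** z | a z. a \<in> G0 \<and> z \<in> center G}"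
  show sub: "?T \<subseteq> G"
    using G_mult G0_sub by (auto simp: center_def)
  have center: "z \<in> G" "\<And>g. g \<in> G \<Longrightarrow> z ** g = g ** z" if "z \<in> center G" for z
    using that by (auto simp: center_def)
  have adj_center: "adj_mat z \<in> center G" if z: "z \<in> center G" for z
  proof -
    have "adj_mat z ** g = g ** adj_mat z" if "g \<in> G" for g
      using arg_cong[OF center(2)[OF z G_adj[OF that]], of adj_mat] by (simp add: adj_mult)
    then show ?thesis
      using center(1)[OF z] G_adj by (simp add: center_def)
  qed
  have mult_center: "y ** z \<in> center G" if "y \<in> center G" "z \<in> center G" for y z
  proof -
    have "y ** z ** g = g ** (y ** z)" if g: "g \<in> G" for g
    proof -
      have "y ** z ** g = y ** (z ** g)"
        by (simp only: matrix_mul_assoc)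
      also have "\<dots> = y ** g ** z"
        by (simp only: center(2)[OF \<open>z \<in> center G\<close> g] matrix_mul_assoc)
      finally show ?thesis
        by (simp only: center(2)[OF \<open>y \<in> center G\<close> g] matrix_mul_assoc)
    qed
    then show ?thesis
      unfolding center_def using G_mult[OF center(1)[OF that(1)] center(1)[OF that(2)]] by blast
  qed
  have adj_G0: "adj_mat a \<in> G0" if "a \<in> G0" for a
    using G0_subgroup that unitary_inv(2)[OF G_unitary[OF subsetD[OF G0_sub that]]] unfolding is_subgroup_def by metis
  have "is_subgroup ?T"
  proof (rule is_subgroup_unitaryI)
    have "mat 1 \<in> G0" "mat 1 \<in> center G"
      using G0_subgroup G_1 by (auto simp: is_subgroup_def center_def)
    then show "mat 1 \<in> ?T"
      by (intro CollectI exI[of _ "mat 1"] conjI) simp_all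
    show "x ** y \<in> ?T" if xy: "x \<in> ?T" "y \<in> ?T" for x y
    proof -
      obtain a z b u where x: "x = a ** z" "a \<in> G0" "z \<in> center G" and y: "y = b ** u" "b \<in> G0" "u \<in> center G"
        using xy by blast
      have "x ** y = a ** (z ** b) ** u"
        by (simp add: x y matrix_mul_assoc)
      also have "\<dots> = (a ** b) ** (z ** u)"
        by (simp only: center(2)[OF x(3) subsetD[OF G0_sub y(2)]] matrix_mul_assoc)
      finally show ?thesis
        using G0_subgroup x y mult_center unfolding is_subgroup_def by blast
    qed
    show "adj_mat x \<in> ?T" if xT: "x \<in> ?T" for x
    proof -
      obtain a z where x: "x = a ** z" "a \<in> G0" "z \<in> center G"
        using xT by blast
      have "adj_mat x = adj_mat a ** adj_mat z"
        using center(2)[OF adj_center[OF x(3)] subsetD[OF G0_sub adj_G0[OF x(2)]]]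
        by (simp add: x(1) adj_mult)
      then show ?thesis
        using adj_G0[OF x(2)] adj_center[OF x(3)] by blast
    qed
  qed (use sub G_unitary in blast)
  moreover have "closed ?T"
  proof -
    have "?T = (\<lambda>(a, z). a ** z) ` (G0 \<times> center G)"
      by auto
    moreover have "compact G0"
      by (rule compact_compact_unitary_group[OF compact_unitary_group_identity_component[OF G]])
    then have "compact ((\<lambda>(a, z). a ** z) ` (G0 \<times> center G))"
      unfolding case_prod_beta
      by (intro compact_continuous_image compact_Times compact_center continuous_intros)
    ultimately show ?thesis
      using compact_imp_closed by metis
  qed
  moreover have "conj_class G (two_value l m P) \<subseteq> ?T"
  proof -
    have "two_value l m Q \<in> ?T" if Q: "Q \<in> projs" for Q
    proof -
      define w where "w = l * cnj m"
      have w: "w * m = l" "cmod w = 1"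
        using lm by (simp_all add: w_def norm_mult mult.assoc mult.commute[of "cnj m"] complex_norm_square[symmetric])
      \<comment> \<open>The angle for which exp (\<i> t) = w, so that the exponential has the ratio
        of values l / m.\<close>
      define t where "t = Arg w"
      have "exp (\<i> * t) = w"
        using w(2) cis_Arg[of w] by (cases "w = 0") (simp_all add: t_def cis_conv_exp sgn_div_norm)
      then have a: "mexp (t *\<^sub>R gen_elem Q) = mat (exp (- t * shift)) ** two_value w 1 Q"
        using mexp_gen_elem[OF Q, of t] by simp
      \<comment> \<open>The scalar \<open>?z\<close> cancels the factor exp (- t shift) and restores
        the value m on the kernel of \<open>Q\<close>. It is a quotient of two elements of
        \<open>G\<close>, hence in \<open>G\<close>, and central as a scalar.\<close>
      let ?a = "mexp (t *\<^sub>R gen_elem Q)" and ?z = "mat (m * exp (t * shift))"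
      have "mat (m * exp (t * shift)) ** ?a = mat (m * exp (t * shift) * exp (- t * shift)) ** two_value w 1 Q"
        unfolding a by (simp only: matrix_mul_assoc mat_mult_mat)
      also have "\<dots> = mat m ** two_value w 1 Q"
        by (simp add: mult.assoc flip: exp_add)
      also have "\<dots> = two_value l m Q"
        using w(1) by (simp add: two_value_def vec_eq_iff mat_mult_nth) (simp add: mat_def algebra_simps)
      finally have eq: "?a ** ?z = two_value l m Q"
        by (simp only: mat_commute[of ?a])
      have aL: "t *\<^sub>R gen_elem Q \<in> L"
        using gen_elem_L[OF Q] L_subspace by (simp add: subspace_scale)
      then have a0: "?a \<in> G0"
        by (rule mexp_in_identity_component)
      then have "unitary_mat ?a" "?a \<in> G"
        using G_unitary G0_sub by blast+
      then have "?z = adj_mat ?a ** two_value l m Q"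
        unfolding eq[symmetric] matrix_mul_assoc by (simp add: unitary_mat_def)
      then have "?z \<in> G"
        using G_mult[OF G_adj[OF \<open>?a \<in> G\<close>] two_value_G[OF Q]] by simp
      then have "?z \<in> center G"
        by (auto simp: center_def intro: mat_commute[symmetric])
      then show ?thesis
        using a0 eq[symmetric] by blast
    qed
    then show ?thesis
      by (auto simp: conj_class_eq)
  qed
  ultimately have "closure (gen_subgroup (conj_class G (two_value l m P))) \<subseteq> ?T"
    by (intro closure_minimal gen_subgroup_least)
  then show "G \<subseteq> ?T"
    using gen by blast
qed


lemma G_commute_imp_scalar:
  assumes "X \<in> L" "\<And>k. k \<in> G \<Longrightarrow> k ** X = X ** k"
  shows "\<exists>c. X = mat c"
  using schur_skew[OF irr L_skew] assms by blast

section \<open>The simple part of the Lie algebra\<close>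

definition gens :: "'n cmat set" where
  "gens = {ad_proj Q X | Q X. Q \<in> projs \<and> X \<in> L}"

text \<open>\<open>S\<close> stands in for the derived algebra of \<open>L\<close>. Only brackets
  with conjugates of \<i> P are taken, since for these the exponentials can be written as
  commutators.\<close>

definition S :: "'n cmat set" where
  "S = span gens"

lemma S_subspace: "subspace S"
  by (simp add: S_def)

lemma S_sub_L: "S \<subseteq> L"
  unfolding S_def by (rule span_minimal[OF _ L_subspace]) (auto simp: gens_def ad_proj_L)

lemma S_Ad:
  assumes k: "k \<in> G" and X: "X \<in> S"
  shows "k ** X ** adj_mat k \<in> S"
proof -
  have "subspace {X. k ** X ** adj_mat k \<in> S}"
    using S_subspace by (simp add: subspace_def matrix_ring_simps)
  moreover have "gens \<subseteq> {X. k ** X ** adj_mat k \<in> S}"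
  proof
    fix Y assume "Y \<in> gens"
    then obtain Q X where "Q \<in> projs" "X \<in> L" "Y = ad_proj Q X"
      by (auto simp: gens_def)
    then have "k ** Y ** adj_mat k \<in> gens"
      using ad_proj_conj[OF G_unitary[OF k]] projs_conj[OF k] L_Ad[OF k] unfolding gens_def by blast
    then show "Y \<in> {X. k ** X ** adj_mat k \<in> S}"
      by (simp add: S_def span_base)
  qed
  ultimately have "S \<subseteq> {X. k ** X ** adj_mat k \<in> S}"
    unfolding S_def by (intro span_minimal)
  then show ?thesis
    using X by blast
qed

lemma S_bracket: "X \<in> L \<Longrightarrow> Y \<in> S \<Longrightarrow> X ** Y - Y ** X \<in> S"
  by (rule Ad_stable_imp_bracket[OF S_subspace S_Ad])

lemma S_trace:
  assumes "X \<in> S"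
  shows "trace X = 0"
proof -
  have "subspace {X :: 'n cmat. trace X = 0}"
    by (simp add: subspace_def trace_add trace_scaleR) (simp add: trace_def)
  then have "S \<subseteq> {X. trace X = 0}"
    unfolding S_def by (intro span_minimal) (auto simp: gens_def trace_ad_proj)
  then show ?thesis
    using assms by blast
qed

lemma S_scalar: "mat c \<in> S \<Longrightarrow> c = 0"
  using S_trace[of "mat c"] by (simp add: trace_mat)

text \<open>Let R be the component of \<open>X\<close> orthogonal to \<open>S\<close> and Y =
  \<open>gen_elem Q\<close>. The squared norm of [R, Y] is the product of R with [Y, [R, Y]], which
  lies in \<open>S\<close>; so R commutes with every \<open>Q\<close>, hence with \<open>G\<close>,
  and is scalar by Schur.\<close>

lemma L_decomp:
  assumes X: "X \<in> L"
  shows "\<exists>D\<in>S. \<exists>c. X = D + mat c"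
proof -
  obtain D R where D: "D \<in> S" and R: "\<And>W. W \<in> S \<Longrightarrow> R \<bullet> W = 0" and DR: "X = D + R"
    using orthogonal_subspace_decomp_exists[of S X] S_subspace
    by (metis orthogonal_def span_base span_eq_iff)
  have RL: "R \<in> L"
    using subspace_diff[OF L_subspace X subsetD[OF S_sub_L D]] by (simp add: DR)
  have "Q ** R = R ** Q" if Q: "Q \<in> projs" for Q
  proof -
    let ?Y = "gen_elem Q"
    have B: "R ** ?Y - ?Y ** R \<in> L"
      by (rule L_bracket[OF RL gen_elem_L[OF Q]])
    have "?Y ** W - W ** ?Y \<in> S" if "W \<in> L" for W
      unfolding ad_proj_gen_elem[symmetric] S_def using that Q by (intro span_base) (auto simp: gens_def)
    then have "(R ** ?Y - ?Y ** R) \<bullet> (R ** ?Y - ?Y ** R) = 0"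
      unfolding inner_bracket[OF L_skew[OF gen_elem_L[OF Q]], of R "R ** ?Y - ?Y ** R"]
      by (intro R) (use B in blast)
    then have "ad_proj Q R = 0"
      by (simp add: ad_proj_gen_elem)
    then show ?thesis
      by (simp add: ad_proj_eq_0_iff)
  qed
  then obtain c where "R = mat c"
    using G_commute_imp_scalar[OF RL] projs_commute_imp_G_commute by blast
  then show ?thesis
    using D DR by blast
qed

lemma iP_decomp:
  assumes Q: "Q \<in> projs"
  shows "\<exists>D\<in>S. \<exists>c. mat \<i> ** Q = D + mat c"
proof -
  obtain D c where "D \<in> S" "gen_elem Q = D + mat c"
    using L_decomp[OF gen_elem_L[OF Q]] by blast
  then have "mat \<i> ** Q = D + mat (c + shift)"
    by (simp add: iQ_eq mat_add add_ac)
  then show ?thesis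
    using \<open>D \<in> S\<close> by blast
qed

text \<open>On matrices \<open>ad_proj Q\<close> is the bracket with an element of \<open>S\<close>,
  so an ideal is stable under it, and then under all of \<open>G\<close>.\<close>

lemma ideal_Ad:
  assumes I: "lie_ideal S I" and k: "k \<in> G" and X: "X \<in> I"
  shows "k ** X ** adj_mat k \<in> I"
proof (rule ad_proj_stable_imp_Ad_stable[OF _ _ k X])
  show "subspace I"
    using I by (simp add: lie_ideal_def)
  fix Q X assume Q: "Q \<in> projs" and X: "X \<in> I"
  obtain D c where D: "D \<in> S" "mat \<i> ** Q = D + mat c"
    using iP_decomp[OF Q] by blast
  then have "ad_proj Q X = D ** X - X ** D"
    using ad_proj_shift[of Q X c] by simp
  then show "ad_proj Q X \<in> I"
    using I D(1) X by (simp add: lie_ideal_def)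
qed

text \<open>Stability under conjugation spreads the commutation from \<open>P\<close> to
  \<open>G\<close>; Schur then makes the elements scalar, and trace zero makes them vanish.\<close>

lemma ideal_commute_P_trivial:
  assumes I: "lie_ideal S I" and comm: "\<And>X. X \<in> I \<Longrightarrow> P ** X = X ** P"
  shows "I = {0}"
proof -
  have IS: "I \<subseteq> S" "0 \<in> I"
    using I by (auto simp: lie_ideal_def subspace_0)
  have "X = 0" if X: "X \<in> I" for X
  proof -
    have "k ** X = X ** k" if "k \<in> G" for k
      by (rule P_commute_imp_G_commute[OF ideal_Ad[OF I] comm that X])
    then obtain c where "X = mat c"
      using G_commute_imp_scalar X IS S_sub_L by blast
    moreover have "c = 0"
      using S_scalar X IS \<open>X = mat c\<close> by blast
    ultimately show ?thesis
      by simp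
  qed
  then show ?thesis
    using IS by blast
qed

lemma iP_commute: "mat \<i> ** P = A + mat c \<Longrightarrow> A ** X = X ** A \<Longrightarrow> P ** X = X ** P"
  by (rule iP_commute_imp) (simp add: matrix_add_ldistrib matrix_add_rdistrib mat_commute[of X])

text \<open>Modulo scalars both \<i> P and \<open>L\<close> lie in \<open>S\<close>; commutativity
  there would make \<open>P\<close> commute with \<open>L\<close>.\<close>

lemma S_nonabelian: "\<exists>X\<in>S. \<exists>Y\<in>S. X ** Y \<noteq> Y ** X"
proof (rule ccontr)
  assume ab: "\<not> ?thesis"
  obtain D c where D: "D \<in> S" "mat \<i> ** P = D + mat c"
    using iP_decomp[OF P_projs] by blast
  have "P ** X = X ** P" if X: "X \<in> L" for X
  proof (rule iP_commute[OF D(2)])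
    obtain E d where E: "E \<in> S" "X = E + mat d"
      using L_decomp[OF X] by blast
    then have "D ** E = E ** D"
      using ab D by blast
    then show "D ** X = X ** D"
      by (simp add: E(2) matrix_add_ldistrib matrix_add_rdistrib mat_commute[of D])
  qed
  then show False
    using P_not_commute_L by blast
qed

text \<open>With \<open>J\<close> the complement of \<open>I\<close>, split \<i> P into A in
  \<open>I\<close> and B + d, where B is in \<open>J\<close> and the scalar d is absorbed. Since
  \<open>L\<close> is the sum of \<open>I\<close>, \<open>J\<close> and scalars, \<open>I\<close>
  and \<open>J\<close> act irreducibly together. If A is scalar, \<open>P\<close> commutes with
  \<open>I\<close>; if B + d is scalar, with \<open>J\<close>; the ideal concerned vanishes.\<close>

lemma S_ideals:
  assumes I: "lie_ideal S I"
  shows "I = {0} \<or> I = S"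
proof -
  have Isub: "subspace I" "I \<subseteq> S" and Ibr: "\<And>X Y. X \<in> S \<Longrightarrow> Y \<in> I \<Longrightarrow> X ** Y - Y ** X \<in> I"
    using I by (auto simp: lie_ideal_def)
  have skew: "X \<in> S \<Longrightarrow> adj_mat X = - X" for X
    using L_skew S_sub_L by blast
  define J where "J = {X \<in> S. \<forall>Y\<in>I. X \<bullet> Y = 0}"
  have Jsub: "subspace J"
    using S_subspace by (simp add: J_def subspace_def inner_left_distrib)
  have J: "lie_ideal S J"
    unfolding lie_ideal_def
  proof (intro conjI ballI Jsub)
    show "J \<subseteq> S"
      by (auto simp: J_def)
    fix X Y assume X: "X \<in> S" and Y: "Y \<in> J"
    have "X ** Y - Y ** X \<in> S"
      using S_bracket X Y S_sub_L by (auto simp: J_def)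
    moreover have "(X ** Y - Y ** X) \<bullet> W = 0" if "W \<in> I" for W
    proof -
      have "(Y ** X - X ** Y) \<bullet> W = Y \<bullet> (X ** W - W ** X)"
        by (rule inner_bracket[OF skew[OF X]])
      also have "\<dots> = 0"
        using Y Ibr[OF X that] by (simp add: J_def)
      finally show ?thesis
        by (simp add: inner_diff_left)
    qed
    ultimately show "X ** Y - Y ** X \<in> J"
      by (simp add: J_def)
  qed
  have IJ: "X ** Y = Y ** X" if X: "X \<in> I" and Y: "Y \<in> J" for X Y
  proof -
    have XS: "X \<in> S" and YS: "Y \<in> S"
      using X Y Isub by (auto simp: J_def)
    have "X ** Y - Y ** X \<in> J"
      using J XS Y by (simp add: lie_ideal_def)
    moreover have "Y ** X - X ** Y \<in> I"
      by (rule Ibr[OF YS X])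
    then have "X ** Y - Y ** X \<in> I"
      using subspace_neg[OF Isub(1)] by fastforce
    ultimately have "(X ** Y - Y ** X) \<bullet> (X ** Y - Y ** X) = 0"
      by (simp add: J_def)
    then show ?thesis
      by simp
  qed
  have decomp: "\<exists>A\<in>I. \<exists>B\<in>J. X = A + B" if X: "X \<in> S" for X
  proof -
    obtain A B where A: "A \<in> I" and B: "\<And>W. W \<in> I \<Longrightarrow> B \<bullet> W = 0" and AB: "X = A + B"
      using orthogonal_subspace_decomp_exists[of I X] Isub
      by (metis orthogonal_def span_base span_eq_iff)
    have "B \<in> S"
      using subspace_diff[OF S_subspace X subsetD[OF Isub(2) A]] by (simp add: AB)
    then show ?thesis
      using A B AB by (auto simp: J_def)
  qed
  obtain D d where D: "D \<in> S" "mat \<i> ** P = D + mat d"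
    using iP_decomp[OF P_projs] by blast
  obtain A B where AB: "A \<in> I" "B \<in> J" "D = A + B"
    using decomp[OF D(1)] by blast
  let ?Z = "B + mat d"
  have iP: "mat \<i> ** P = A + ?Z"
    by (simp add: D AB)
  have "irreducible_rep (I \<union> J)"
    unfolding irreducible_rep_def
  proof (intro allI impI)
    fix W assume W: "complex_subspace W \<and> (\<forall>g\<in>I \<union> J. \<forall>w\<in>W. g *v w \<in> W)"
    have "X *v w \<in> W" if X: "X \<in> L" and w: "w \<in> W" for X w
    proof -
      obtain E c where E: "E \<in> S" "X = E + mat c"
        using L_decomp[OF X] by blast
      obtain F H where "F \<in> I" "H \<in> J" "E = F + H"
        using decomp[OF E(1)] by blast
      then show ?thesis
        using W w by (simp add: E matrix_vector_mult_add_rdistrib mat_mult_vec complex_subspace_def)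
    qed
    then show "W = {0} \<or> W = UNIV"
      using L_irreducible W unfolding irreducible_rep_def by blast
  qed
  moreover have AB_comm: "A ** B = B ** A"
    by (rule IJ[OF AB(1,2)])
  have "A ** ?Z = ?Z ** A"
    by (simp add: matrix_add_ldistrib matrix_add_rdistrib AB_comm mat_commute[of A])
  moreover have "?Z ** X = X ** ?Z" if "X \<in> I" for X
    using IJ[OF that AB(2)] by (simp add: matrix_add_ldistrib matrix_add_rdistrib mat_commute[of X])
  moreover have "(A + ?Z) ** (A + ?Z) = mat \<i> ** (A + ?Z)"
    using iP_square by (simp only: iP)
  ultimately have "(\<exists>c. A = mat c) \<or> (\<exists>c. ?Z = mat c)"
    using IJ AB(1) skew[of A] Isub(2)
    by (intro commuting_sum_scalar[of I J]) auto
  then show ?thesis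
  proof (elim disjE exE)
    fix c assume "A = mat c"
    then have "mat \<i> ** P = B + mat (c + d)"
      by (simp add: iP mat_add add_ac)
    then have "P ** X = X ** P" if "X \<in> I" for X
      using iP_commute IJ[OF that AB(2)] by metis
    then show ?thesis
      using ideal_commute_P_trivial[OF I] by blast
  next
    fix c assume "?Z = mat c"
    then have "mat \<i> ** P = A + mat c"
      by (simp add: iP)
    then have "P ** X = X ** P" if "X \<in> J" for X
      using iP_commute IJ[OF AB(1) that] by metis
    then have "J = {0}"
      using ideal_commute_P_trivial[OF J] by blast
    then have "S \<subseteq> I"
      using decomp by fastforce
    then show ?thesis
      using Isub by blast
  qed
qed

section \<open>The Lie algebra of the commutator subgroup\<close>

abbreviation H :: "'n cmat set" where "H \<equiv> commutator_subgroup G0"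

lemma G0_unitary: "a \<in> G0 \<Longrightarrow> unitary_mat a"
  using G_unitary G0_sub by blast

lemma H_sub: "H \<subseteq> G"
  using commutator_subgroup_sub[OF G0_subgroup] G0_sub by blast

text \<open>\<open>exp (\<pi> (\<i> Q - c))\<close> is a scalar multiple of the reflection \<open>1 - 2 Q\<close>, which anticommutes with
  \<open>N = [\<i> Q, X]\<close>; so its commutator with \<open>exp (t N / 2)\<close> is \<open>exp (t N)\<close>.\<close>

lemma gens_in_lie_algebra_H: "gens \<subseteq> lie_algebra H"
proof
  fix N assume "N \<in> gens"
  then obtain Q X where Q: "Q \<in> projs" and X: "X \<in> L" and N: "N = ad_proj Q X"
    by (auto simp: gens_def)
  have NL: "N \<in> L"
    by (simp add: N ad_proj_L[OF Q X])
  define b where "b = mexp (pi *\<^sub>R gen_elem Q)"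
  have "pi *\<^sub>R gen_elem Q \<in> L"
    using gen_elem_L[OF Q] L_subspace by (simp add: subspace_scale)
  then have bG: "b \<in> G0"
    unfolding b_def by (rule mexp_in_identity_component)
  have b: "b = mat (exp (- pi * shift)) ** two_value (- 1) 1 Q"
    unfolding b_def mexp_gen_elem[OF Q] by (simp add: mult.commute[of \<i>])
  have bN: "b ** N = - N ** b"
  proof -
    have QQ: "Q ** (Q ** X) = Q ** X" "X ** Q ** Q = X ** Q"
      using projs_idem[OF Q] by (simp_all add: matrix_mul_assoc) (simp add: projs_idem[OF Q] flip: matrix_mul_assoc)
    \<comment> \<open>In blocks with respect to \<open>Q\<close> this commutator is off-diagonal,
      while the two-valued matrix is -1 and 1 on the diagonal; hence they anticommute.\<close>
    let ?E = "Q ** X - X ** Q"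
    have 1: "two_value (- 1) 1 Q ** ?E = ?E + mat (- 2) ** (Q ** X - Q ** X ** Q)"
      by (simp only: two_value_def matrix_add_rdistrib matrix_mul_lid matrix_mul_assoc[symmetric] matrix_diff_ldistrib QQ)
         (simp add: matrix_mul_assoc)
    have "?E ** two_value (- 1) 1 Q = ?E + mat (- 2) ** (?E ** Q)"
      unfolding two_value_def matrix_add_ldistrib mat_left_commute by simp
    then have 2: "?E ** two_value (- 1) 1 Q = ?E + mat (- 2) ** (Q ** X ** Q - X ** Q)"
      by (simp only: matrix_diff_rdistrib[of _ _ Q] QQ)
    have "two_value (- 1) 1 Q ** ?E = - (?E ** two_value (- 1) 1 Q)"
      unfolding 1 2 by (simp add: vec_eq_iff mat_mult_nth algebra_simps)
    then have E: "mat \<i> ** (two_value (- 1) 1 Q ** ?E) = mat \<i> ** (- (?E ** two_value (- 1) 1 Q))"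
      by simp
    let ?s = "exp (- pi * shift)"
    have "b ** N = mat ?s ** (mat \<i> ** (two_value (- 1) 1 Q ** ?E))"
      unfolding b N ad_proj_def mat_mult_mult mat_mult_left ..
    also have "\<dots> = - (mat (\<i> * ?s) ** (?E ** two_value (- 1) 1 Q))"
      unfolding E matrix_minus_right mat_mult_left by (simp only: mult.commute[of \<i>])
    also have "\<dots> = - N ** b"
      unfolding b N ad_proj_def matrix_minus_left mat_mult_mult ..
    finally show ?thesis .
  qed
  have bb: "b ** adj_mat b = mat 1" "adj_mat b ** b = mat 1" "matrix_inv b = adj_mat b"
    using G0_unitary[OF bG] unitary_inv(2) by (auto simp: unitary_mat_def)
  have "mexp (t *\<^sub>R N) \<in> H" for t
  proof -
    let ?M = "(t / 2) *\<^sub>R N"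
    have a: "mexp ?M \<in> G0"
      using NL L_subspace by (intro mexp_in_identity_component) (simp add: subspace_scale)
    have "b ** N ** adj_mat b = - (N ** (b ** adj_mat b))"
      by (simp only: bN matrix_minus_left matrix_mul_assoc)
    then have "b ** N ** adj_mat b = - N"
      by (simp add: bb)
    then have "b ** (- ?M) ** adj_mat b = ?M"
      by (simp add: matrix_minus_left matrix_minus_right matrix_scaleR_left matrix_scaleR_right)
    then have conj: "b ** mexp (- ?M) ** adj_mat b = mexp ?M"
      using mexp_conj[OF bb(2,1), of "- ?M"] by simp
    have "mexp ?M ** b ** matrix_inv (mexp ?M) ** matrix_inv b = mexp ?M ** (b ** mexp (- ?M) ** adj_mat b)"
      by (simp only: matrix_inv_mexp bb(3) matrix_mul_assoc)
    also have "\<dots> = mexp (?M + ?M)"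
      unfolding conj by (rule mexp_add_commuting[symmetric]) simp
    also have "?M + ?M = t *\<^sub>R N"
      by (simp flip: scaleR_add_left)
    finally have "mexp (t *\<^sub>R N) = mexp ?M ** b ** matrix_inv (mexp ?M) ** matrix_inv b"
      by simp
    then show ?thesis
      unfolding commutator_subgroup_def using a bG by (intro subsetD[OF gen_subgroup_superset]) blast
  qed
  then show "N \<in> lie_algebra H"
    by (simp add: lie_algebra_def)
qed

text \<open>The Lie algebra of the closure contains \<open>S\<close>, and a further scalar direction
  would contradict determinant 1. As the elements of \<open>gens\<close> are already directions of
  \<open>H\<close> and span \<open>S\<close>, the result comes back from the closure to
  \<open>H\<close>.\<close>

lemma lie_algebra_H: "lie_algebra H = S"
proof
  let ?K = "closure H"
  have Hsub: "is_subgroup H"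
    by (rule is_subgroup_commutator_subgroup[OF G0_subgroup])
  have K: "compact_unitary_group ?K"
    by (rule compact_unitary_group_closure[OF G Hsub H_sub])
  have KG: "?K \<subseteq> G"
    by (rule closure_minimal[OF H_sub G_closed])
  have HK: "lie_algebra H \<subseteq> lie_algebra ?K"
    using closure_subset by (fastforce simp: lie_algebra_def)
  have SK: "S \<subseteq> lie_algebra ?K"
    unfolding S_def using gens_in_lie_algebra_H HK by (intro span_minimal subspace_lie_algebra[OF K]) blast
  have "closed {a :: 'n cmat. det a = 1}"
    unfolding det_def by (intro closed_Collect_eq continuous_intros)
  then have "?K \<subseteq> {a. det a = 1}"
    using det_commutator_subgroup[OF G0_unitary] by (intro closure_minimal) blast
  then have detK: "det a = 1" if "a \<in> ?K" for a
    using that by blast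
  have KS: "lie_algebra ?K \<subseteq> S"
  proof
    fix X assume X: "X \<in> lie_algebra ?K"
    then have "X \<in> L"
      using KG by (auto simp: lie_algebra_def)
    then obtain D c where D: "D \<in> S" "X = D + mat c"
      using L_decomp by blast
    have "mat c \<in> lie_algebra ?K"
      using subspace_diff[OF subspace_lie_algebra[OF K] X subsetD[OF SK D(1)]] by (simp add: D)
    moreover have "t *\<^sub>R mat c = (mat (t * c) :: 'n cmat)" for t
      by (simp only: mat_mult_mat flip: mat_of_real_mult)
    ultimately have "mat (exp (complex_of_real t * c)) \<in> ?K" for t
      by (simp add: lie_algebra_def mexp_mat)
    then have "exp (complex_of_real t * c) ^ CARD('n) = 1" for t
      using detK det_mat by metis
    then have one: "exp (of_nat CARD('n) * (complex_of_real t * c)) = 1" for t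
      by (simp add: exp_of_nat_mult)
    have "Re c = 0"
      using one[of 1] by (simp add: exp_eq_1)
    moreover have "Im c = 0"
    proof (rule ccontr)
      assume "Im c \<noteq> 0"
      \<comment> \<open>The parameter is chosen to give the exponent imaginary part pi, which is not
        an even multiple of pi.\<close>
      then have "Im (of_nat CARD('n) * (complex_of_real (pi / (real CARD('n) * Im c)) * c)) = pi"
        by simp
      then obtain n :: int where "pi = real_of_int (2 * n) * pi"
        using one[of "pi / (real CARD('n) * Im c)"] unfolding exp_eq_1 by metis
      then have "real_of_int (2 * n) = 1"
        by simp
      then have "2 * n = 1"
        by linarith
      then show False
        by presburger
    qed
    ultimately have "c = 0"
      by (simp add: complex_eq_iff)
    then show "X \<in> S"
      using D by simp
  qed
  show "lie_algebra H \<subseteq> S"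
    using HK KS by blast
  have "lie_algebra ?K \<subseteq> lie_algebra H"
    using KS unfolding S_def
    by (intro lie_algebra_subset_of_generators[OF K Hsub closure_subset gens_in_lie_algebra_H])
  then show "S \<subseteq> lie_algebra H"
    using SK by blast
qed

lemma simple_commutator_subgroup: "simple_lie_group H"
  unfolding simple_lie_group_def simple_lie_algebra_def lie_algebra_H
proof (intro conjI allI impI)
  show "is_subgroup H"
    by (rule is_subgroup_commutator_subgroup[OF G0_subgroup])
  show "connected H"
    by (rule connected_commutator_subgroup[OF G0_subgroup _ G0_unitary]) (auto simp: identity_component_def)
qed (use S_nonabelian S_ideals in blast)+

end

section \<open>From the two-eigenvalue property to the locale\<close>

lemma noncentral_if_quotient_dim_pos:
  fixes G :: "'n::finite cmat set"
  assumes G: "compact_unitary_group G" and dim: "quotient_by_center_dim G > 0"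
  shows "\<exists>X\<in>lie_algebra G. \<exists>k\<in>G. k ** X \<noteq> X ** k"
proof (rule ccontr)
  assume comm: "\<not> ?thesis"
  \<comment> \<open>If conjugation fixes the Lie algebra pointwise, every one-parameter group is
    central; the truncated difference of dimensions is then 0.\<close>
  have "lie_algebra G \<subseteq> lie_algebra (center G)"
  proof
    fix X assume X: "X \<in> lie_algebra G"
    have "mexp (t *\<^sub>R X) ** k = k ** mexp (t *\<^sub>R X)" if k: "k \<in> G" for t k
    proof -
      have u: "adj_mat k ** k = mat 1" "k ** adj_mat k = mat 1"
        using G k by (auto simp: compact_unitary_group_def unitary_mat_def)
      have "k ** X = X ** k"
        using comm X k by blast
      then have "k ** (t *\<^sub>R X) ** adj_mat k = t *\<^sub>R (X ** (k ** adj_mat k))"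
        by (simp add: matrix_scaleR_left matrix_scaleR_right matrix_mul_assoc)
      then have "k ** (t *\<^sub>R X) ** adj_mat k = t *\<^sub>R X"
        by (simp add: u)
      then have "mexp (t *\<^sub>R X) = k ** mexp (t *\<^sub>R X) ** adj_mat k"
        using mexp_conj[OF u, of "t *\<^sub>R X"] by simp
      then have "mexp (t *\<^sub>R X) ** k = k ** mexp (t *\<^sub>R X) ** (adj_mat k ** k)"
        by (metis matrix_mul_assoc)
      then show ?thesis
        by (simp add: u)
    qed
    then show "X \<in> lie_algebra (center G)"
      using X by (simp add: lie_algebra_def center_def)
  qed
  then have "dim (lie_algebra G) \<le> dim (lie_algebra (center G))"
    by (rule dim_subset)
  then show False
    using dim by (simp add: quotient_by_center_dim_def)
qed

theorem theorem1p4: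
  fixes G :: "(complex^'n::finite^'n) set"
  assumes "compact_unitary_group G"
    and "irreducible_rep G"
    and "two_eigenvalue_property G"
    and "quotient_by_center_dim G > 0"
  shows "simple_lie_group (commutator_subgroup (identity_component G)) \<and>
         G = {a ** z | a z. a \<in> identity_component G \<and> z \<in> center G}"
proof -
  obtain g where g: "g \<in> G" "G \<subseteq> closure (gen_subgroup (conj_class G g))"
    and ev: "\<And>x. x \<in> conj_class G g \<Longrightarrow> card (eigenvalues_mat x) = 2 \<and>
        (\<forall>a\<in>eigenvalues_mat x. \<forall>b\<in>eigenvalues_mat x. a \<noteq> b \<longrightarrow> a / b \<noteq> -1)"
    using assms(3) unfolding two_eigenvalue_property_def by blast
  have "mat 1 \<in> G"
    using assms(1) by (simp add: compact_unitary_group_def is_subgroup_def)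
  moreover have "matrix_inv (mat 1 :: 'n cmat) = mat 1"
    by (rule matrix_inv_eqI) simp_all
  ultimately have "g \<in> conj_class G g"
    by (force simp: conj_class_def)
  from ev[OF this] obtain l m where lm: "eigenvalues_mat g = {l, m}" "l \<noteq> m" "l / m \<noteq> -1"
    by (auto simp: card_2_iff)
  have un: "unitary_mat g"
    using assms(1) g(1) by (simp add: compact_unitary_group_def)
  have norm: "cmod l = 1" "cmod m = 1"
    using unitary_eigenvalue_norm[OF un] lm(1) by auto
  \<comment> \<open>Lagrange interpolation: this polynomial in \<open>g\<close> is 1 on the
    eigenspace of l and 0 on that of m.\<close>
  define P where "P = mat (1 / (l - m)) ** (g - mat m)"
  have "mat (l - m) ** P = g - mat m"
    using lm(2) by (simp add: P_def mat_mult_left)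
  then have gP: "g = two_value l m P"
    by (simp add: two_value_def)
  have "(g - mat l) ** (g - mat m) = 0"
    by (rule unitary_two_eigenvalues[OF un lm(1,2)])
  moreover have "(g - mat m) ** (g - mat m) = (g - mat l) ** (g - mat m) + mat (l - m) ** (g - mat m)"
    by (simp add: mat_diff flip: matrix_add_rdistrib)
  ultimately have sq: "(g - mat m) ** (g - mat m) = mat (l - m) ** (g - mat m)"
    by simp
  have "P ** P = P"
    using lm(2) unfolding P_def mat_mult_mult sq mat_mult_left by simp
  \<comment> \<open>The case m = 0 is excluded by the modulus, so division by zero does not distort
    the condition on the ratio.\<close>
  moreover have "l \<noteq> - m"
    using lm(3) norm(2) by (cases "m = 0") auto
  ultimately interpret two_eigenvalue_group G P l m
    using assms(1,2) norm lm(2) g noncentral_if_quotient_dim_pos[OF assms(1,4)]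
    by unfold_locales (simp_all add: gP)
  show ?thesis
    using simple_commutator_subgroup G_eq_G0_center by blast
qed

end
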